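(* Under the clique semantics, the $\exists$-AF problem is undecidable for parametric timed broadcast protocols with no clock: there is no algorithm that, given a PTBP $\mathcal N$ with empty clock set and a state $q_f$, decides whether there exists a network size $N\in\mathbb N$ such that every maximal execution of the network of $N$ processes reaches $q_f$.
   Context: A PTBP is a tuple $\mathcal N=(Q,X,\Sigma,P,q_0,\Delta)$ with finite states $Q$, finite clocks $X$, finite alphabet $\Sigma$, finite timing parameters $P$, initial state $q_0$, and finite edges $\Delta\subseteq Q\times G\times Act\times 2^X\times Q$, where a guard is a finite conjunction of constraints $x\bowtie a$ ($x\in X$, $a\in\mathbb Q_{\ge0}\cup P$), $Act=\{\epsilon\}\cup\{!!m,??m:m\in\Sigma\}$ (internal, broadcast, reception), and the subset of $X$ is the set of clocks reset. With no clocks, all guards are trivially true and parameters play no role. Semantics: for network size $N$, a configuration is a vector of $N$ (state, clock valuation) pairs, initially all in $q_0$ with clocks $0$. A transition: a delay elapses on all clocks; a process $i$ takes an enabled edge $(q_1,g,a,U,q_2)$, moving to $q_2$; if $a=\epsilon$ others are unchanged; if $a=!!m$, in the clique semantics every other process that has an enabled edge labelled $??m$ from its current state takes one such edge, and processes without such an edge are unchanged (non-blocking). A maximal execution is a sequence of transitions from the initial configuration that is infinite or ends in a configuration with no possible transition; it reaches $q_f$ if some process is in $q_f$ at some configuration. *)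

theory Defs
  imports Complex_Main "HOL-Library.Nat_Bijection"
begin

section \<open>Parametric timed broadcast protocols\<close>

datatype cmp = Lt | Le | Eq | Ge | Gt

datatype 'p bound = Const rat | Param 'p

type_synonym ('x, 'p) guard = "('x \<times> cmp \<times> 'p bound) set"

datatype 'm act = Internal | Bcast 'm | Recv 'm

type_synonym ('q, 'x, 'm, 'p) edge = "'q \<times> ('x, 'p) guard \<times> 'm act \<times> 'x set \<times> 'q"

record ('q, 'x, 'm, 'p) ptbp =
  states :: "'q set"
  clocks :: "'x set"
  alphabet :: "'m set"
  params :: "'p set"
  init :: 'q
  edges :: "('q, 'x, 'm, 'p) edge set"

fun bound_over :: "'p set \<Rightarrow> 'p bound \<Rightarrow> bool" where
  "bound_over P (Const r) \<longleftrightarrow> 0 \<le> r"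
| "bound_over P (Param p) \<longleftrightarrow> p \<in> P"

definition guard_over :: "'x set \<Rightarrow> 'p set \<Rightarrow> ('x, 'p) guard \<Rightarrow> bool" where
  "guard_over X P g \<longleftrightarrow> finite g \<and> (\<forall>(x, r, b) \<in> g. x \<in> X \<and> bound_over P b)"

definition wf_ptbp :: "('q, 'x, 'm, 'p) ptbp \<Rightarrow> bool" where
  "wf_ptbp N \<longleftrightarrow>
     finite (states N) \<and> finite (clocks N) \<and> finite (alphabet N) \<and> finite (params N) \<and>
     init N \<in> states N \<and> finite (edges N) \<and>
     (\<forall>(q, g, a, U, q') \<in> edges N.
        q \<in> states N \<and> guard_over (clocks N) (params N) g \<and> set_act a \<subseteq> alphabet N \<and>
        U \<subseteq> clocks N \<and> q' \<in> states N)"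


section \<open>Clique semantics\<close>

text \<open>Below, \<open>v\<close> is a valuation of the parameters and \<open>\<nu>\<close> a valuation of the clocks.\<close>

fun cmp_holds :: "cmp \<Rightarrow> real \<Rightarrow> real \<Rightarrow> bool" where
  "cmp_holds Lt s t \<longleftrightarrow> s < t"
| "cmp_holds Le s t \<longleftrightarrow> s \<le> t"
| "cmp_holds Eq s t \<longleftrightarrow> s = t"
| "cmp_holds Ge s t \<longleftrightarrow> s \<ge> t"
| "cmp_holds Gt s t \<longleftrightarrow> s > t"

fun bound_val :: "('p \<Rightarrow> rat) \<Rightarrow> 'p bound \<Rightarrow> real" where
  "bound_val v (Const r) = of_rat r"
| "bound_val v (Param p) = of_rat (v p)"

definition guard_holds :: "('p \<Rightarrow> rat) \<Rightarrow> ('x \<Rightarrow> real) \<Rightarrow> ('x, 'p) guard \<Rightarrow> bool" where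
  "guard_holds v \<nu> g \<longleftrightarrow> (\<forall>(x, r, b) \<in> g. cmp_holds r (\<nu> x) (bound_val v b))"

type_synonym ('q, 'x) proc = "'q \<times> ('x \<Rightarrow> real)"

text \<open>A configuration of a network of size \<open>n\<close> is a list of length \<open>n\<close>.\<close>

type_synonym ('q, 'x) config = "('q, 'x) proc list"

definition initial_config :: "('q, 'x, 'm, 'p) ptbp \<Rightarrow> nat \<Rightarrow> ('q, 'x) config" where
  "initial_config N n = replicate n (init N, \<lambda>x. 0)"

definition delay :: "('q, 'x, 'm, 'p) ptbp \<Rightarrow> real \<Rightarrow> ('q, 'x) proc \<Rightarrow> ('q, 'x) proc" where
  "delay N d s = (fst s, \<lambda>x. if x \<in> clocks N then snd s x + d else snd s x)"

definition takes ::
  "('q, 'x, 'm, 'p) ptbp \<Rightarrow> ('p \<Rightarrow> rat) \<Rightarrow> 'm act \<Rightarrow> ('q, 'x) proc \<Rightarrow> ('q, 'x) proc \<Rightarrow> bool" where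
  "takes N v a s s' \<longleftrightarrow>
     (\<exists>(q1, g, b, U, q2) \<in> edges N.
        b = a \<and> fst s = q1 \<and> guard_holds v (snd s) g \<and>
        s' = (q2, \<lambda>x. if x \<in> U then 0 else snd s x))"

definition receives ::
  "('q, 'x, 'm, 'p) ptbp \<Rightarrow> ('p \<Rightarrow> rat) \<Rightarrow> 'm \<Rightarrow> ('q, 'x) proc \<Rightarrow> ('q, 'x) proc \<Rightarrow> bool" where
  "receives N v m s s' \<longleftrightarrow>
     (if \<exists>t. takes N v (Recv m) s t then takes N v (Recv m) s s' else s' = s)"

text \<open>One transition is a delay followed by an internal action or a broadcast of process \<open>i\<close>;
  \<open>c1\<close> is the intermediate configuration after the delay.\<close>

definition step ::
  "('q, 'x, 'm, 'p) ptbp \<Rightarrow> ('p \<Rightarrow> rat) \<Rightarrow> ('q, 'x) config \<Rightarrow> ('q, 'x) config \<Rightarrow> bool" where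
  "step N v c c' \<longleftrightarrow> length c' = length c \<and>
     (\<exists>d \<ge> 0. \<exists>c1. c1 = map (delay N d) c \<and> (\<exists>i < length c.
        (takes N v Internal (c1 ! i) (c' ! i) \<and>
           (\<forall>j < length c. j \<noteq> i \<longrightarrow> c' ! j = c1 ! j)) \<or>
        (\<exists>m. takes N v (Bcast m) (c1 ! i) (c' ! i) \<and>
           (\<forall>j < length c. j \<noteq> i \<longrightarrow> receives N v m (c1 ! j) (c' ! j)))))"

text \<open>An execution is a sequence \<open>\<rho> 0, \<rho> 1, \<dots>\<close> with \<open>L \<le> \<infinity>\<close> transitions;
  \<open>L = None\<close> stands for \<open>\<infinity>\<close>, and if \<open>L = Some l\<close> the values of \<open>\<rho>\<close> beyond \<open>l\<close> are irrelevant.\<close>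

definition maximal_execution ::
  "('q, 'x, 'm, 'p) ptbp \<Rightarrow> ('p \<Rightarrow> rat) \<Rightarrow> nat \<Rightarrow> (nat \<Rightarrow> ('q, 'x) config) \<Rightarrow> nat option \<Rightarrow> bool" where
  "maximal_execution N v n \<rho> L \<longleftrightarrow>
     \<rho> 0 = initial_config N n \<and>
     (case L of
        None \<Rightarrow> \<forall>k. step N v (\<rho> k) (\<rho> (Suc k))
      | Some l \<Rightarrow> (\<forall>k < l. step N v (\<rho> k) (\<rho> (Suc k))) \<and> (\<nexists>c. step N v (\<rho> l) c))"

definition reaches :: "(nat \<Rightarrow> ('q, 'x) config) \<Rightarrow> nat option \<Rightarrow> 'q \<Rightarrow> bool" where
  "reaches \<rho> L q \<longleftrightarrow>
     (\<exists>k. (case L of None \<Rightarrow> True | Some l \<Rightarrow> k \<le> l) \<and> q \<in> fst ` set (\<rho> k))"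

definition all_reach :: "('q, 'x, 'm, 'p) ptbp \<Rightarrow> ('p \<Rightarrow> rat) \<Rightarrow> nat \<Rightarrow> 'q \<Rightarrow> bool" where
  "all_reach N v n qf \<longleftrightarrow> (\<forall>\<rho> L. maximal_execution N v n \<rho> L \<longrightarrow> reaches \<rho> L qf)"

definition exists_AF :: "('q, 'x, 'm, 'p) ptbp \<Rightarrow> 'q \<Rightarrow> bool" where
  "exists_AF N qf \<longleftrightarrow> (\<exists>n v. (\<forall>p \<in> params N. 0 \<le> v p) \<and> all_reach N v n qf)"

text \<open>Without clocks, the parameter valuation is irrelevant.\<close>

lemma takes_clock_free:
  assumes "wf_ptbp N" "clocks N = {}"
  shows "takes N v = takes N w"
proof -
  have "g = {}" if "(q, g, a, U, q') \<in> edges N" for q g a U q'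
    using assms that by (fastforce simp: wf_ptbp_def guard_over_def)
  then have "guard_holds v \<nu> g = guard_holds w \<nu> g"
    if "(q, g, a, U, q') \<in> edges N" for q g a U q' \<nu>
    using that by (force simp: guard_holds_def)
  then show ?thesis
    by (intro ext) (fastforce simp: takes_def)
qed

lemma all_reach_clock_free:
  assumes "wf_ptbp N" "clocks N = {}"
  shows "all_reach N v = all_reach N w"
proof -
  have "receives N v = receives N w"
    by (intro ext) (simp add: receives_def takes_clock_free[OF assms, of v w])
  then have "step N v = step N w"
    by (intro ext) (simp add: step_def takes_clock_free[OF assms, of v w])
  then have "maximal_execution N v = maximal_execution N w"
    by (intro ext) (simp add: maximal_execution_def split: option.split)
  then show ?thesis
    by (intro ext) (simp add: all_reach_def)
qed

lemma exists_AF_clock_free: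
  assumes "wf_ptbp N" "clocks N = {}"
  shows "exists_AF N qf \<longleftrightarrow> (\<exists>n. all_reach N v n qf)"
proof
  assume "exists_AF N qf"
  then show "\<exists>n. all_reach N v n qf"
    unfolding exists_AF_def using all_reach_clock_free[OF assms] by metis
next
  assume "\<exists>n. all_reach N v n qf"
  then obtain n where "all_reach N v n qf" ..
  then have "all_reach N (\<lambda>_. 0) n qf"
    using all_reach_clock_free[OF assms] by metis
  then show "exists_AF N qf"
    unfolding exists_AF_def by force
qed


section \<open>Decidability\<close>

text \<open>Algorithms are partial recursive functions over tuples of natural numbers:
  \<open>rec_eval f xs y\<close> says that \<open>f\<close> terminates on \<open>xs\<close> with result \<open>y\<close>.\<close>

datatype recf =
  Zero
| Succ
| Proj nat
| Comp recf "recf list"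
| Prec recf recf
| Mu recf

inductive rec_eval :: "recf \<Rightarrow> nat list \<Rightarrow> nat \<Rightarrow> bool" where
  "rec_eval Zero xs 0"
| "rec_eval Succ [x] (Suc x)"
| "i < length xs \<Longrightarrow> rec_eval (Proj i) xs (xs ! i)"
| "length ys = length gs \<Longrightarrow> (\<forall>i < length gs. rec_eval (gs ! i) xs (ys ! i)) \<Longrightarrow>
   rec_eval f ys z \<Longrightarrow> rec_eval (Comp f gs) xs z"
| "rec_eval f xs y \<Longrightarrow> rec_eval (Prec f g) (0 # xs) y"
| "rec_eval (Prec f g) (n # xs) r \<Longrightarrow> rec_eval g (n # r # xs) y \<Longrightarrow>
   rec_eval (Prec f g) (Suc n # xs) y"
| "rec_eval f (n # xs) 0 \<Longrightarrow> (\<forall>i < n. \<exists>y > 0. rec_eval f (i # xs) y) \<Longrightarrow>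
   rec_eval (Mu f) xs n"

lemma rec_eval_det: "rec_eval f xs y \<Longrightarrow> rec_eval f xs z \<Longrightarrow> y = z"
proof (induction arbitrary: z rule: rec_eval.induct)
  case (1 xs)
  then show ?case by cases auto
next
  case (2 x)
  then show ?case by cases auto
next
  case (3 i xs)
  from 3(2) show ?case by cases auto
next
  case (4 ys gs xs f y)
  from 4(5) obtain ys' where ys': "length ys' = length gs"
    "\<forall>i < length gs. rec_eval (gs ! i) xs (ys' ! i)" "rec_eval f ys' z"
    by cases auto
  have "ys = ys'"
    using "4.hyps" "4.IH"(1) ys' by (intro nth_equalityI) auto
  then show ?case using "4.IH"(2) ys'(3) by simp
next
  case (5 f xs y g)
  from 5(3) have "rec_eval f xs z" by cases auto
  then show ?case by (rule 5(2))
next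
  case (6 f g n xs r y)
  from 6(5) obtain r' where "rec_eval (Prec f g) (n # xs) r'" "rec_eval g (n # r' # xs) z"
    by cases auto
  then show ?case using 6 by blast
next
  case (7 f n xs)
  from 7(4) obtain "rec_eval f (z # xs) 0" "\<forall>i < z. \<exists>y > 0. rec_eval f (i # xs) y"
    by cases auto
  then show ?case
    using 7(1,2,3) by (metis less_irrefl linorder_neqE_nat)
qed

text \<open>The problem \<open>P\<close> on the instances \<open>I\<close>, which are presented to the algorithm through \<open>code\<close>.\<close>

definition decidable :: "('i \<Rightarrow> nat) \<Rightarrow> 'i set \<Rightarrow> ('i \<Rightarrow> bool) \<Rightarrow> bool" where
  "decidable code I P \<longleftrightarrow> (\<exists>f. \<forall>i \<in> I. rec_eval f [code i] (if P i then 1 else 0))"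


section \<open>Encoding of protocols as natural numbers\<close>

text \<open>As inputs to an algorithm, protocols have natural numbers as names of their states, clocks,
  messages and parameters. Finite sets are encoded by \<^const>\<open>set_encode\<close>.\<close>

type_synonym nat_ptbp = "(nat, nat, nat, nat) ptbp"

fun cmp_code :: "cmp \<Rightarrow> nat" where
  "cmp_code Lt = 0"
| "cmp_code Le = 1"
| "cmp_code Eq = 2"
| "cmp_code Ge = 3"
| "cmp_code Gt = 4"

fun bound_code :: "nat bound \<Rightarrow> nat" where
  "bound_code (Const r) =
     sum_encode (Inl (prod_encode (map_prod int_encode int_encode (quotient_of r))))"
| "bound_code (Param p) = sum_encode (Inr p)"

fun constr_code :: "nat \<times> cmp \<times> nat bound \<Rightarrow> nat" where
  "constr_code (x, r, b) = prod_encode (x, prod_encode (cmp_code r, bound_code b))"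

fun act_code :: "nat act \<Rightarrow> nat" where
  "act_code Internal = 0"
| "act_code (Bcast m) = Suc (sum_encode (Inl m))"
| "act_code (Recv m) = Suc (sum_encode (Inr m))"

fun edge_code :: "(nat, nat, nat, nat) edge \<Rightarrow> nat" where
  "edge_code (q, g, a, U, q') =
     list_encode [q, set_encode (constr_code ` g), act_code a, set_encode U, q']"

definition ptbp_code :: "nat_ptbp \<Rightarrow> nat" where
  "ptbp_code N =
     list_encode [set_encode (states N), set_encode (clocks N), set_encode (alphabet N),
       set_encode (params N), init N, set_encode (edge_code ` edges N)]"

definition instance_code :: "nat_ptbp \<times> nat \<Rightarrow> nat" where
  "instance_code = (\<lambda>(N, qf). prod_encode (ptbp_code N, qf))"

text \<open>The encoding loses no information.\<close>

lemma bound_code_inj: "bound_code a = bound_code b \<Longrightarrow> a = b"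
proof (induction a)
  case (Const r)
  then show ?case
    by (cases b) (auto simp: prod_encode_eq sum_encode_eq int_encode_eq map_prod_def
        intro!: quotient_of_inject split: prod.splits)
next
  case (Param p)
  then show ?case by (cases b) (auto simp: sum_encode_eq)
qed

lemma cmp_code_inj: "cmp_code a = cmp_code b \<Longrightarrow> a = b"
  by (cases a; cases b; simp)

lemma constr_code_inj: "inj constr_code"
  by (auto simp: inj_def prod_encode_eq dest: cmp_code_inj bound_code_inj)

lemma act_code_inj: "act_code a = act_code b \<Longrightarrow> a = b"
  by (cases a; cases b; simp add: sum_encode_eq)

lemma edge_code_inj:
  assumes "\<And>q g a U q'. (q, g, a, U, q') \<in> E \<Longrightarrow> finite g \<and> finite U"
  shows "inj_on edge_code E"
proof (rule inj_onI, unfold split_paired_all)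
  fix q1 g1 a1 U1 q1' q2 g2 a2 U2 q2'
  assume e: "(q1, g1, a1, U1, q1') \<in> E" "(q2, g2, a2, U2, q2') \<in> E"
    and eq: "edge_code (q1, g1, a1, U1, q1') = edge_code (q2, g2, a2, U2, q2')"
  have fin: "finite g1" "finite U1" "finite g2" "finite U2" using assms e by blast+
  have "q1 = q2" "a1 = a2" "q1' = q2'" "set_encode U1 = set_encode U2"
    "set_encode (constr_code ` g1) = set_encode (constr_code ` g2)"
    using eq by (auto simp: list_encode_eq dest: act_code_inj simp del: list_encode.simps)
  moreover from this fin have "U1 = U2" "constr_code ` g1 = constr_code ` g2"
    by (simp_all add: set_encode_eq)
  moreover from this have "g1 = g2" using constr_code_inj by (simp add: inj_image_eq_iff)
  ultimately show "(q1, g1, a1, U1, q1') = (q2, g2, a2, U2, q2')" by simp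
qed

lemma instance_code_inj: "inj_on instance_code {(N, qf). wf_ptbp N}"
proof -
  have "N = M" if wf: "wf_ptbp N" "wf_ptbp M" and eq: "ptbp_code N = ptbp_code M"
    for N M :: nat_ptbp
  proof -
    have fin: "finite (states K)" "finite (clocks K)" "finite (alphabet K)" "finite (params K)"
      "finite (edges K)" if "K \<in> {N, M}" for K
      using that wf by (auto simp: wf_ptbp_def)
    have inj: "inj_on edge_code (edges N \<union> edges M)"
    proof (rule edge_code_inj)
      fix q g a U q'
      assume "(q, g, a, U, q') \<in> edges N \<union> edges M"
      then obtain K where K: "K \<in> {N, M}" "(q, g, a, U, q') \<in> edges K" by auto
      then have "wf_ptbp K" using wf by auto
      with K(2) have "finite g" "U \<subseteq> clocks K"
        by (auto simp: wf_ptbp_def guard_over_def)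
      then show "finite g \<and> finite U"
        using fin(2)[OF K(1)] finite_subset by blast
    qed
    have "states N = states M" "clocks N = clocks M" "alphabet N = alphabet M"
      "params N = params M" "init N = init M" "edge_code ` edges N = edge_code ` edges M"
      using eq fin
      by (auto simp: ptbp_code_def list_encode_eq set_encode_eq simp del: list_encode.simps)
    moreover from this inj have "edges N = edges M"
      using inj_on_image_eq_iff[of edge_code "edges N \<union> edges M" "edges N" "edges M"] by auto
    ultimately show ?thesis by simp
  qed
  then show ?thesis
    by (auto simp: inj_on_def instance_code_def prod_encode_eq)
qed

end

theory Submission
  imports Defs "HOL-Library.Countable" "HOL-Library.Multiset"
begin

text \<open>Programs with counters are simulated by broadcast networks: one process is elected leader and
  follows the control flow, and a counter is the number of processes in a dedicated state. Every
  decrement or increment is announced by the process that performs it, and every zero test by the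
  leader, so that each move that deviates from the program is received by a process that then enters
  the target state. Hence the only executions that avoid the target state are those that follow the
  program, or that stop doing so because there are too few processes. Thus the target is
  unavoidable for some network size if and only if the program halts.

  An algorithm for the problem is refuted by diagonalisation. Let a program, given a number \<open>e\<close>,
  run the algorithm on the protocol that is obtained from the edges encoded by \<open>e\<close> by adding a
  gadget that loads \<open>e\<close> into the first counter, and let it halt if and only if the answer is
  negative. Now let \<open>e\<close> encode the edges of the protocol that simulates this very program.\<close>


section \<open>Loop programs\<close>

text \<open>A program doubles as the control state of the machine: it is the list of instructions that
  remain to be executed. \<open>Loop r b\<close> stands for \<open>while r > 0 do (r := r - 1; b)\<close>.\<close>

datatype instr = Inc nat | Loop nat "instr list"

type_synonym prog = "instr list"
type_synonym store = "nat \<Rightarrow> nat"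

inductive run1 :: "prog \<times> store \<Rightarrow> prog \<times> store \<Rightarrow> bool" where
  run1_Inc: "run1 (Inc r # k, s) (k, s(r := Suc (s r)))"
| run1_Loop: "s r = Suc n \<Longrightarrow> run1 (Loop r b # k, s) (b @ Loop r b # k, s(r := n))"
| run1_exit: "s r = 0 \<Longrightarrow> run1 (Loop r b # k, s) (k, s)"

abbreviation runs :: "prog \<times> store \<Rightarrow> prog \<times> store \<Rightarrow> bool" where
  "runs \<equiv> run1\<^sup>*\<^sup>*"

text \<open>The continuation \<open>k\<close> is universally quantified because the control state is
  the whole remaining program; this makes programs compose by concatenation.\<close>

definition exec :: "prog \<Rightarrow> store \<Rightarrow> store \<Rightarrow> bool" where
  "exec p s t \<longleftrightarrow> (\<forall>k. runs (p @ k, s) (k, t))"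

lemma exec_Nil: "exec [] s s"
  by (simp add: exec_def)

lemma exec_append: "exec p s t \<Longrightarrow> exec q t u \<Longrightarrow> exec (p @ q) s u"
  unfolding exec_def by (metis append.assoc rtranclp_trans)

lemma exec_Cons: "exec [i] s t \<Longrightarrow> exec p t u \<Longrightarrow> exec (i # p) s u"
  using exec_append[of "[i]"] by simp

lemma exec_Inc: "exec [Inc r] s (s(r := Suc (s r)))"
  by (auto simp: exec_def intro: run1_Inc)

lemma exec_Loop_exit: "s r = 0 \<Longrightarrow> exec [Loop r b] s s"
  by (auto simp: exec_def intro: run1_exit)

lemma exec_Loop_step:
  assumes "s r = Suc n" "exec b (s(r := n)) t" "exec [Loop r b] t u"
  shows "exec [Loop r b] s u"
  unfolding exec_def
proof
  fix k
  have "run1 ([Loop r b] @ k, s) (b @ [Loop r b] @ k, s(r := n))"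
    using run1_Loop[of s r n b k] assms(1) by simp
  moreover have "runs (b @ [Loop r b] @ k, s(r := n)) ([Loop r b] @ k, t)"
    using assms(2) unfolding exec_def by blast
  moreover have "runs ([Loop r b] @ k, t) (k, u)"
    using assms(3) unfolding exec_def by blast
  ultimately show "runs ([Loop r b] @ k, s) (k, u)"
    by (meson converse_rtranclp_into_rtranclp rtranclp_trans)
qed

lemma exec_clear: "exec [Loop r []] s (s(r := 0))"
proof (induction "s r" arbitrary: s)
  case 0
  then have "s(r := 0) = s" by auto
  with 0 show ?case using exec_Loop_exit[of s r] by simp
next
  case (Suc n)
  have "exec [Loop r []] (s(r := n)) (s(r := 0))"
    using Suc.hyps(1)[of "s(r := n)"] by simp
  with Suc.hyps(2) show ?case
    using exec_Loop_step[where t = "s(r := n)"] exec_Nil by metis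
qed

lemma exec_move:
  assumes "a \<noteq> c"
  shows "exec [Loop a [Inc c]] s (s(a := 0, c := s c + s a))"
proof (induction "s a" arbitrary: s)
  case 0
  then have "s(a := 0, c := s c + s a) = s" by auto
  with 0 show ?case using exec_Loop_exit by metis
next
  case (Suc n)
  let ?s = "s(a := n, c := Suc (s c))"
  have "exec [Inc c] (s(a := n)) ?s"
    using exec_Inc[of c "s(a := n)"] assms by simp
  moreover have "exec [Loop a [Inc c]] ?s (?s(a := 0, c := ?s c + ?s a))"
    using assms by (intro Suc.hyps(1)) simp
  moreover have "?s(a := 0, c := ?s c + ?s a) = s(a := 0, c := s c + s a)"
    using Suc.hyps(2) assms by (auto simp: fun_eq_iff)
  ultimately show ?case
    using exec_Loop_step Suc.hyps(2) by metis
qed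

lemma exec_move2:
  assumes "a \<noteq> c" "a \<noteq> d" "c \<noteq> d"
  shows "exec [Loop a [Inc c, Inc d]] s (s(a := 0, c := s c + s a, d := s d + s a))"
proof (induction "s a" arbitrary: s)
  case 0
  then have "s(a := 0, c := s c + s a, d := s d + s a) = s" by auto
  with 0 show ?case using exec_Loop_exit by metis
next
  case (Suc n)
  let ?s = "s(a := n, c := Suc (s c), d := Suc (s d))"
  have "exec [Inc c, Inc d] (s(a := n)) ?s"
    using exec_Cons[OF exec_Inc[of c "s(a := n)"] exec_Inc[of d]] assms by simp
  moreover have "exec [Loop a [Inc c, Inc d]] ?s (?s(a := 0, c := ?s c + ?s a, d := ?s d + ?s a))"
    using assms by (intro Suc.hyps(1)) simp
  moreover have "?s(a := 0, c := ?s c + ?s a, d := ?s d + ?s a) =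
      s(a := 0, c := s c + s a, d := s d + s a)"
    using Suc.hyps(2) assms by (auto simp: fun_eq_iff)
  ultimately show ?case
    using exec_Loop_step Suc.hyps(2) by metis
qed

text \<open>Registers can only be read by emptying them. Hence \<open>a\<close> is moved to the
  scratch register \<open>b\<close>, from which \<open>a\<close> is restored while \<open>r\<close>
  is filled.\<close>

definition copy :: "nat \<Rightarrow> nat \<Rightarrow> nat \<Rightarrow> prog" where
  "copy a r b = [Loop r [], Loop b [], Loop a [Inc b], Loop b [Inc a, Inc r]]"

lemma exec_copy:
  assumes "a \<noteq> r" "a \<noteq> b" "r \<noteq> b"
  shows "exec (copy a r b) s (s(b := 0, r := s a))"
proof -
  let ?s1 = "s(r := 0)" let ?s2 = "?s1(b := 0)" let ?s3 = "?s2(a := 0, b := ?s2 b + ?s2 a)"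
  let ?s4 = "?s3(b := 0, a := ?s3 a + ?s3 b, r := ?s3 r + ?s3 b)"
  have "exec (copy a r b) s ?s4"
    unfolding copy_def using assms
    by (intro exec_Cons[OF exec_clear] exec_Cons[OF exec_move] exec_move2) auto
  moreover have "?s4 = s(b := 0, r := s a)"
    using assms by (auto simp: fun_eq_iff)
  ultimately show ?thesis by simp
qed


section \<open>Recursive functions are computed by loop programs\<close>

text \<open>The arguments are read from the registers \<open>as\<close>, the result is written to the register \<open>r\<close>,
  and the registers from \<open>b\<close> on are available as scratch space.\<close>

definition implements :: "prog \<Rightarrow> recf \<Rightarrow> nat list \<Rightarrow> nat \<Rightarrow> nat \<Rightarrow> bool" where
  "implements p f as r b \<longleftrightarrow>
     (\<forall>s y. rec_eval f (map s as) y \<longrightarrow>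
        (\<exists>t. exec p s t \<and> t r = y \<and> (\<forall>j<b. j \<noteq> r \<longrightarrow> t j = s j)))"

text \<open>All placements of arguments, result and scratch space are demanded, so that the
  induction over \<open>recf\<close> can put intermediate values into fresh registers from
  \<open>b\<close> on.\<close>

definition compilable :: "recf \<Rightarrow> bool" where
  "compilable f \<longleftrightarrow>
     (\<forall>as r b. (\<forall>a \<in> set as. a < b) \<and> r < b \<and> r \<notin> set as \<longrightarrow> (\<exists>p. implements p f as r b))"

lemma implementsD:
  assumes "implements p f as r b" "rec_eval f (map s as) y"
  obtains t where "exec p s t" "t r = y" "\<And>j. j < b \<Longrightarrow> j \<noteq> r \<Longrightarrow> t j = s j"
  using assms unfolding implements_def by blast

lemma compilableD:
  assumes "compilable f" "\<And>a. a \<in> set as \<Longrightarrow> a < b" "r < b" "r \<notin> set as"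
  obtains p where "implements p f as r b"
  using assms unfolding compilable_def by blast

lemma compilable_Zero: "compilable Zero"
  unfolding compilable_def
proof (intro allI impI)
  fix as :: "nat list" and r b :: nat
  have "implements [Loop r []] Zero as r b"
    unfolding implements_def
  proof (intro allI impI)
    fix s :: store and y
    assume "rec_eval Zero (map s as) y"
    then have "y = 0" by cases auto
    then show "\<exists>t. exec [Loop r []] s t \<and> t r = y \<and> (\<forall>j<b. j \<noteq> r \<longrightarrow> t j = s j)"
      using exec_clear[of r s] by (intro exI[of _ "s(r := 0)"]) auto
  qed
  then show "\<exists>p. implements p Zero as r b" ..
qed

lemma compilable_Succ: "compilable Succ"
  unfolding compilable_def
proof (intro allI impI)
  fix as :: "nat list" and r b :: nat
  assume as: "(\<forall>a\<in>set as. a < b) \<and> r < b \<and> r \<notin> set as"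
  have "implements (copy (hd as) r b @ [Inc r]) Succ as r b"
    unfolding implements_def
  proof (intro allI impI)
    fix s :: store and y
    assume "rec_eval Succ (map s as) y"
    then obtain a where a: "as = [a]" "y = Suc (s a)" by cases auto
    have "exec (copy (hd as) r b) s (s(b := 0, r := s a))"
      using as a by (auto intro: exec_copy)
    from exec_append[OF this exec_Inc[of r]]
    have "exec (copy (hd as) r b @ [Inc r]) s (s(b := 0, r := Suc (s a)))"
      by (simp del: append.simps)
    then show "\<exists>t. exec (copy (hd as) r b @ [Inc r]) s t \<and> t r = y \<and> (\<forall>j<b. j \<noteq> r \<longrightarrow> t j = s j)"
      by (intro exI[where x = "s(b := 0, r := Suc (s a))"]) (simp add: a)
  qed
  then show "\<exists>p. implements p Succ as r b" ..
qed

lemma compilable_Proj: "compilable (Proj i)"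
  unfolding compilable_def
proof (intro allI impI)
  fix as :: "nat list" and r b :: nat
  assume as: "(\<forall>a\<in>set as. a < b) \<and> r < b \<and> r \<notin> set as"
  have "implements (copy (as ! i) r b) (Proj i) as r b"
    unfolding implements_def
  proof (intro allI impI)
    fix s :: store and y
    assume "rec_eval (Proj i) (map s as) y"
    then have i: "i < length as" "y = s (as ! i)" by (cases; auto)+
    have "exec (copy (as ! i) r b) s (s(b := 0, r := s (as ! i)))"
      using as i nth_mem[OF i(1)] by (intro exec_copy) auto
    then show "\<exists>t. exec (copy (as ! i) r b) s t \<and> t r = y \<and> (\<forall>j<b. j \<noteq> r \<longrightarrow> t j = s j)"
      by (intro exI[where x = "s(b := 0, r := s (as ! i))"]) (simp add: i)
  qed
  then show "\<exists>p. implements p (Proj i) as r b" ..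
qed

definition implements_list :: "prog \<Rightarrow> recf list \<Rightarrow> nat list \<Rightarrow> nat \<Rightarrow> bool" where
  "implements_list p gs as c \<longleftrightarrow>
     (\<forall>s ys. length ys = length gs \<longrightarrow> (\<forall>i<length gs. rec_eval (gs ! i) (map s as) (ys ! i)) \<longrightarrow>
        (\<exists>t. exec p s t \<and> map t [c..<c + length gs] = ys \<and> (\<forall>j<c. t j = s j)))"

lemma implements_listD:
  assumes "implements_list p gs as c" "length ys = length gs"
    "\<forall>i<length gs. rec_eval (gs ! i) (map s as) (ys ! i)"
  obtains t where "exec p s t" "map t [c..<c + length gs] = ys" "\<And>j. j < c \<Longrightarrow> t j = s j"
  using assms unfolding implements_list_def by blast

text \<open>The programs run one after the other; each result survives because later programs
  preserve all registers below their own result.\<close>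

lemma compilable_list:
  assumes "\<And>g. g \<in> set gs \<Longrightarrow> compilable g" "\<And>a. a \<in> set as \<Longrightarrow> a < c"
  shows "\<exists>p. implements_list p gs as c"
  using assms
proof (induction gs arbitrary: c)
  case Nil
  have "implements_list [] [] as c"
    unfolding implements_list_def using exec_Nil by auto
  then show ?case ..
next
  case (Cons g gs)
  obtain p where p: "implements p g as c (Suc c)"
    using compilableD[of g as "Suc c" c] Cons.prems by (metis less_Suc_eq less_irrefl list.set_intros(1))
  obtain q where q: "implements_list q gs as (Suc c)"
    using Cons.IH[of "Suc c"] Cons.prems less_SucI by fastforce
  have "implements_list (p @ q) (g # gs) as c"
    unfolding implements_list_def
  proof (intro allI impI)
    fix s :: store and ys
    assume len: "length ys = length (g # gs)"
      and ev: "\<forall>i<length (g # gs). rec_eval ((g # gs) ! i) (map s as) (ys ! i)"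
    obtain y zs where ys: "ys = y # zs" using len by (cases ys) auto
    have "rec_eval g (map s as) y" using ev ys by force
    from implementsD[OF p this] obtain t where
      t: "exec p s t" "t c = y" "\<And>j. j < Suc c \<Longrightarrow> j \<noteq> c \<Longrightarrow> t j = s j" by blast
    have "map t as = map s as" using t(3) Cons.prems(2) by force
    then have "\<forall>i<length gs. rec_eval (gs ! i) (map t as) (zs ! i)"
      using ev ys by (auto simp del: map_eq_conv)
    from implements_listD[OF q _ this] len ys obtain u where
      u: "exec q t u" "map u [Suc c..<Suc c + length gs] = zs" "\<And>j. j < Suc c \<Longrightarrow> u j = t j"
      by (metis length_Cons nat.inject)
    show "\<exists>t. exec (p @ q) s t \<and> map t [c..<c + length (g # gs)] = ys \<and> (\<forall>j<c. t j = s j)"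
      using exec_append[OF t(1) u(1)] t(2,3) u(2,3) ys
      by (intro exI[of _ u]) (auto simp: upt_conv_Cons simp del: upt_Suc)
  qed
  then show ?case ..
qed

lemma compilable_Comp:
  assumes "compilable f" "\<And>g. g \<in> set gs \<Longrightarrow> compilable g"
  shows "compilable (Comp f gs)"
  unfolding compilable_def
proof (intro allI impI)
  fix as :: "nat list" and r b :: nat
  assume as: "(\<forall>a\<in>set as. a < b) \<and> r < b \<and> r \<notin> set as"
  let ?c = "b + length gs"
  obtain p where p: "implements_list p gs as b"
    using compilable_list[of gs as b] assms(2) as by blast
  \<comment> \<open>The values of \<open>gs\<close> occupy the block \<open>[b..<?c]\<close>, so the
    scratch space for \<open>f\<close> starts at \<open>?c\<close>.\<close>
  obtain q where q: "implements q f [b..<?c] r ?c"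
    using compilableD[OF assms(1), of "[b..<?c]" ?c r] as by auto
  have "implements (p @ q) (Comp f gs) as r b"
    unfolding implements_def
  proof (intro allI impI)
    fix s :: store and y
    assume "rec_eval (Comp f gs) (map s as) y"
    then obtain ys where ys: "length ys = length gs"
      "\<forall>i<length gs. rec_eval (gs ! i) (map s as) (ys ! i)" "rec_eval f ys y"
      by cases auto
    from implements_listD[OF p ys(1,2)] obtain t where
      t: "exec p s t" "map t [b..<?c] = ys" "\<And>j. j < b \<Longrightarrow> t j = s j" by blast
    with ys(3) have "rec_eval f (map t [b..<?c]) y" by simp
    from implementsD[OF q this] obtain u where
      u: "exec q t u" "u r = y" "\<And>j. j < ?c \<Longrightarrow> j \<noteq> r \<Longrightarrow> u j = t j" by blast
    show "\<exists>t. exec (p @ q) s t \<and> t r = y \<and> (\<forall>j<b. j \<noteq> r \<longrightarrow> t j = s j)"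
      using exec_append[OF t(1) u(1)] t(3) u(2,3) by (intro exI[of _ u]) auto
  qed
  then show "\<exists>p. implements p (Comp f gs) as r b" ..
qed

text \<open>A value at \<open>n\<close> is built up from the values at all smaller arguments. As
  \<open>implements\<close> speaks only about arguments with a value, this is what makes each round
  of the compiled recursion terminate.\<close>

lemma rec_eval_Prec_prefix:
  "rec_eval (Prec f g) (n # xs) y \<Longrightarrow> j \<le> n \<Longrightarrow> \<exists>z. rec_eval (Prec f g) (j # xs) z"
proof (induction n arbitrary: y)
  case 0
  then show ?case by auto
next
  case (Suc n)
  show ?case
  proof (cases "j = Suc n")
    case False
    from Suc.prems(1) obtain z where "rec_eval (Prec f g) (n # xs) z" by cases auto
    with False Suc show ?thesis by auto
  qed (use Suc.prems in auto)
qed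

lemma compilable_Prec:
  assumes "compilable f" "compilable g"
  shows "compilable (Prec f g)"
  unfolding compilable_def
proof (intro allI impI)
  fix as :: "nat list" and r b :: nat
  assume as: "(\<forall>a\<in>set as. a < b) \<and> r < b \<and> r \<notin> set as"
  show "\<exists>p. implements p (Prec f g) as r b"
  proof (cases as)
    case Nil
    \<comment> \<open>\<open>Prec f g\<close> has no value on the empty argument list, so any
      program will do.\<close>
    then have "implements [] (Prec f g) as r b"
      unfolding implements_def by (auto elim: rec_eval.cases)
    then show ?thesis ..
  next
    case (Cons a as')
    then have as': "a < b" "\<And>j. j \<in> set as' \<Longrightarrow> j < b" and r: "r < b" using as by auto
    \<comment> \<open>Register \<open>b\<close> counts the completed rounds, \<open>b + 1\<close>
      holds the value reached, \<open>b + 2\<close> the number of rounds left and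
      \<open>b + 3\<close> the next value; scratch space starts at \<open>b + 4\<close>.\<close>
    obtain p where p: "implements p f as' (b + 1) (b + 4)"
      using compilableD[OF assms(1), of as' "b + 4" "b + 1"] as' by fastforce
    obtain q where q: "implements q g (b # (b + 1) # as') (b + 3) (b + 4)"
      using compilableD[OF assms(2), of "b # (b + 1) # as'" "b + 4" "b + 3"] as' by fastforce
    let ?body = "q @ copy (b + 3) (b + 1) (b + 4) @ [Inc b]"
    let ?loop = "[Loop (b + 2) ?body]"
    \<comment> \<open>Invariant: \<open>b + 1\<close> holds the value at the argument
      \<open>s b\<close>, and \<open>s b + m\<close> is the argument asked for.\<close>
    have loop: "\<exists>t. exec ?loop s t \<and> t (b + 1) = y \<and> (\<forall>j<b. t j = s j)"
      if "s (b + 2) = m" "rec_eval (Prec f g) (s b # map s as') (s (b + 1))"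
        "rec_eval (Prec f g) ((s b + m) # map s as') y" for s m y
      using that
    proof (induction m arbitrary: s)
      case 0
      then have "s (b + 1) = y" using rec_eval_det by auto
      then show ?case using 0 exec_Loop_exit by blast
    next
      case (Suc m)
      obtain z where z: "rec_eval (Prec f g) (Suc (s b) # map s as') z"
        using rec_eval_Prec_prefix[OF Suc.prems(3)] by fastforce
      from z obtain w where w: "rec_eval (Prec f g) (s b # map s as') w"
        "rec_eval g (s b # w # map s as') z" by cases auto
      have w_eq: "w = s (b + 1)" using rec_eval_det[OF w(1) Suc.prems(2)] .
      let ?s = "s(b + 2 := m)"
      have same: "map ?s as' = map s as'" using as' by fastforce
      have "rec_eval g (map ?s (b # (b + 1) # as')) z" using w(2) w_eq same by (simp del: map_eq_conv)
      from implementsD[OF q this] obtain t where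
        t: "exec q ?s t" "t (b + 3) = z" "\<And>j. j < b + 4 \<Longrightarrow> j \<noteq> b + 3 \<Longrightarrow> t j = ?s j" by blast
      let ?t = "t(b + 4 := 0, b + 1 := t (b + 3))"
      let ?u = "?t(b := Suc (?t b))"
      have "exec ?body ?s ?u"
        by (intro exec_append[OF t(1)] exec_append[OF exec_copy exec_Inc]) auto
      moreover have "\<exists>v. exec ?loop ?u v \<and> v (b + 1) = y \<and> (\<forall>j<b. v j = ?u j)"
      proof (rule Suc.IH)
        have eq: "map ?u as' = map s as'" using as' t(3) by fastforce
        show "?u (b + 2) = m" using t(3) by simp
        show "rec_eval (Prec f g) (?u b # map ?u as') (?u (b + 1))"
          unfolding eq using z t(2) t(3)[of b] by simp
        show "rec_eval (Prec f g) ((?u b + m) # map ?u as') y"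
          unfolding eq using Suc.prems(3) t(3)[of b] by simp
      qed
      then obtain v where v: "exec ?loop ?u v" "v (b + 1) = y" "\<forall>j<b. v j = ?u j" by blast
      ultimately have "exec ?loop s v" using exec_Loop_step Suc.prems(1) by blast
      then show ?case using v(2,3) t(3) by (intro exI[of _ v]) auto
    qed
    let ?p = "copy a (b + 2) (b + 4) @ [Loop b []] @ p @ ?loop @ copy (b + 1) r (b + 4)"
    have "implements ?p (Prec f g) as r b"
      unfolding implements_def
    proof (intro allI impI)
      fix s :: store and y
      assume "rec_eval (Prec f g) (map s as) y"
      then have ev: "rec_eval (Prec f g) (s a # map s as') y" using Cons by simp
      obtain z where z: "rec_eval (Prec f g) (0 # map s as') z"
        using rec_eval_Prec_prefix[OF ev] by blast
      then have fz: "rec_eval f (map s as') z" by cases auto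
      let ?s = "s(b + 4 := 0, b + 2 := s a, b := 0)"
      have s: "exec (copy a (b + 2) (b + 4) @ [Loop b []]) s ?s"
        using as' by (intro exec_append[OF exec_copy exec_clear]) auto
      have same: "map ?s as' = map s as'" using as' by fastforce
      have "rec_eval f (map ?s as') z" unfolding same by (rule fz)
      from implementsD[OF p this] obtain t where
        t: "exec p ?s t" "t (b + 1) = z" "\<And>j. j < b + 4 \<Longrightarrow> j \<noteq> b + 1 \<Longrightarrow> t j = ?s j" by blast
      have eq: "map t as' = map s as'" using as' t(3) by fastforce
      have "\<exists>u. exec ?loop t u \<and> u (b + 1) = y \<and> (\<forall>j<b. u j = t j)"
      proof (rule loop)
        show "t (b + 2) = s a" using t(3) by simp
        show "rec_eval (Prec f g) (t b # map t as') (t (b + 1))"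
          unfolding eq using z t(2) t(3)[of b] by simp
        show "rec_eval (Prec f g) ((t b + s a) # map t as') y"
          unfolding eq using ev t(3)[of b] by simp
      qed
      then obtain u where u: "exec ?loop t u" "u (b + 1) = y" "\<forall>j<b. u j = t j" by blast
      have cp: "exec (copy (b + 1) r (b + 4)) u (u(b + 4 := 0, r := u (b + 1)))"
        using r by (intro exec_copy) auto
      have "exec ?p s (u(b + 4 := 0, r := u (b + 1)))"
        using exec_append[OF s exec_append[OF t(1) exec_append[OF u(1) cp]]] by simp
      then show "\<exists>t. exec ?p s t \<and> t r = y \<and> (\<forall>j<b. j \<noteq> r \<longrightarrow> t j = s j)"
        by (intro exI[where x = "u(b + 4 := 0, r := u (b + 1))"]) (use u t(3) in auto)
    qed
    then show ?thesis ..
  qed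
qed

lemma compilable_Mu:
  assumes "compilable f"
  shows "compilable (Mu f)"
  unfolding compilable_def
proof (intro allI impI)
  fix as :: "nat list" and r b :: nat
  assume as: "(\<forall>a\<in>set as. a < b) \<and> r < b \<and> r \<notin> set as"
  \<comment> \<open>Register \<open>b\<close> holds the candidate and \<open>b + 1\<close> the value
    of \<open>f\<close> at it. The loop tests whether this value is positive; its decrement does no
    harm, since \<open>p\<close> overwrites \<open>b + 1\<close>.\<close>
  obtain p where p: "implements p f (b # as) (b + 1) (b + 2)"
    using compilableD[OF assms(1), of "b # as" "b + 2" "b + 1"] as by fastforce
  let ?body = "Inc b # p"
  let ?loop = "[Loop (b + 1) ?body]"
  let ?p = "[Loop b []] @ p @ ?loop @ copy b r (b + 2)"
  have "implements ?p (Mu f) as r b"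
    unfolding implements_def
  proof (intro allI impI)
    fix s0 :: store and n
    assume "rec_eval (Mu f) (map s0 as) n"
    then have zero: "rec_eval f (n # map s0 as) 0"
      and pos: "\<And>i. i < n \<Longrightarrow> \<exists>y>0. rec_eval f (i # map s0 as) y" by (cases; blast)+
    have loop: "\<exists>t. exec ?loop s t \<and> t b = n \<and> (\<forall>j<b. t j = s j)"
      if "s b \<le> n" "map s as = map s0 as" "rec_eval f (s b # map s as) (s (b + 1))" for s
      using that
    proof (induction "n - s b" arbitrary: s)
      case 0
      then have "s b = n" by simp
      with 0 zero have "s (b + 1) = 0" using rec_eval_det by metis
      then show ?case using \<open>s b = n\<close> exec_Loop_exit by blast
    next
      case (Suc m)
      then have lt: "s b < n" by simp
      from pos[OF this] obtain y where "y > 0" "rec_eval f (s b # map s0 as) y" by blast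
      then have "s (b + 1) > 0" using rec_eval_det Suc.prems by metis
      then obtain v where v: "s (b + 1) = Suc v" using gr0_implies_Suc by blast
      let ?s = "s(b + 1 := v, b := Suc (s b))"
      have ex: "exec [Inc b] (s(b + 1 := v)) ?s" using exec_Inc[of b "s(b + 1 := v)"] by simp
      \<comment> \<open>The next candidate is at most \<open>n\<close>: it is \<open>n\<close>
        itself, with value 0, or a smaller one, with a positive value. So \<open>p\<close>
        terminates on it.\<close>
      obtain z where z: "rec_eval f (Suc (s b) # map s0 as) z"
        using pos[of "Suc (s b)"] zero lt by (cases "Suc (s b) = n") auto
      have same: "map ?s as = map s0 as" unfolding Suc.prems(2)[symmetric] using as by fastforce
      with z have "rec_eval f (map ?s (b # as)) z" using same by (simp del: map_eq_conv)
      from implementsD[OF p this] obtain t where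
        t: "exec p ?s t" "t (b + 1) = z" "\<And>j. j < b + 2 \<Longrightarrow> j \<noteq> b + 1 \<Longrightarrow> t j = ?s j" by blast
      have eq: "map t as = map s0 as" unfolding same[symmetric] using as t(3) by fastforce
      have "\<exists>u. exec ?loop t u \<and> u b = n \<and> (\<forall>j<b. u j = t j)"
      proof (rule Suc.hyps(1))
        show "m = n - t b" "t b \<le> n" using t(3)[of b] Suc.hyps(2) lt by auto
        show "map t as = map s0 as" by (rule eq)
        show "rec_eval f (t b # map t as) (t (b + 1))"
          unfolding eq using t(2) t(3)[of b] z by simp
      qed
      then obtain u where u: "exec ?loop t u" "u b = n" "\<forall>j<b. u j = t j" by blast
      have "exec ?loop s u"
        using exec_Loop_step[OF v exec_Cons[OF ex t(1)] u(1)] .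
      then show ?case using u(2,3) t(3) by (intro exI[of _ u]) auto
    qed
    let ?s = "s0(b := 0)"
    have same: "map ?s as = map s0 as" using as by fastforce
    obtain z where z: "rec_eval f (0 # map s0 as) z"
      using pos[of 0] zero by (cases n) auto
    then have "rec_eval f (map ?s (b # as)) z" using same by (simp del: map_eq_conv)
    from implementsD[OF p this] obtain t where
      t: "exec p ?s t" "t (b + 1) = z" "\<And>j. j < b + 2 \<Longrightarrow> j \<noteq> b + 1 \<Longrightarrow> t j = ?s j" by blast
    have eq: "map t as = map s0 as" unfolding same[symmetric] using as t(3) by fastforce
    have "\<exists>u. exec ?loop t u \<and> u b = n \<and> (\<forall>j<b. u j = t j)"
    proof (rule loop)
      show "t b \<le> n" using t(3)[of b] by simp
      show "map t as = map s0 as" by (rule eq)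
      show "rec_eval f (t b # map t as) (t (b + 1))"
        unfolding eq using t(2) t(3)[of b] z by simp
    qed
    then obtain u where u: "exec ?loop t u" "u b = n" "\<forall>j<b. u j = t j" by blast
    have cp: "exec (copy b r (b + 2)) u (u(b + 2 := 0, r := u b))"
      using as by (intro exec_copy) auto
    have "exec ?p s0 (u(b + 2 := 0, r := u b))"
      using exec_append[OF exec_clear exec_append[OF t(1) exec_append[OF u(1) cp]]] .
    then show "\<exists>t. exec ?p s0 t \<and> t r = n \<and> (\<forall>j<b. j \<noteq> r \<longrightarrow> t j = s0 j)"
      by (intro exI[where x = "u(b + 2 := 0, r := u b)"]) (use u t(3) in auto)
  qed
  then show "\<exists>p. implements p (Mu f) as r b" ..
qed

lemma compilable: "compilable f"
  by (induction f)
    (auto intro: compilable_Zero compilable_Succ compilable_Proj compilable_Comp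
      compilable_Prec compilable_Mu)


section \<open>Computable arithmetic\<close>

definition computable1 :: "(nat \<Rightarrow> nat) \<Rightarrow> bool" where
  "computable1 F \<longleftrightarrow> (\<exists>f. \<forall>x. rec_eval f [x] (F x))"

definition computable2 :: "(nat \<Rightarrow> nat \<Rightarrow> nat) \<Rightarrow> bool" where
  "computable2 F \<longleftrightarrow> (\<exists>f. \<forall>x y. rec_eval f [x, y] (F x y))"

lemma rec_eval_Comp1: "rec_eval g xs y \<Longrightarrow> rec_eval f [y] z \<Longrightarrow> rec_eval (Comp f [g]) xs z"
  by (rule rec_eval.intros(4)[of "[y]"]) auto

lemma rec_eval_Comp2:
  "rec_eval g xs y \<Longrightarrow> rec_eval h xs z \<Longrightarrow> rec_eval f [y, z] w \<Longrightarrow> rec_eval (Comp f [g, h]) xs w"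
  by (rule rec_eval.intros(4)[of "[y, z]"]) (auto simp: less_Suc_eq)

lemma rec_eval_Proj: "i < length xs \<Longrightarrow> y = xs ! i \<Longrightarrow> rec_eval (Proj i) xs y"
  by (simp add: rec_eval.intros(3))

lemma rec_eval_Prec:
  assumes "rec_eval f xs (F 0)" "\<And>i. rec_eval g (i # F i # xs) (F (Suc i))"
  shows "rec_eval (Prec f g) (n # xs) (F n)"
  by (induction n) (auto intro: rec_eval.intros assms)

lemma computable1_id: "computable1 (\<lambda>x. x)"
  unfolding computable1_def by (rule exI[of _ "Proj 0"]) (simp add: rec_eval_Proj)

lemma computable1_comp: "computable1 F \<Longrightarrow> computable1 G \<Longrightarrow> computable1 (\<lambda>x. F (G x))"
  unfolding computable1_def by (meson rec_eval_Comp1)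

lemma computable1_comp2:
  "computable2 H \<Longrightarrow> computable1 F \<Longrightarrow> computable1 G \<Longrightarrow> computable1 (\<lambda>x. H (F x) (G x))"
  unfolding computable1_def computable2_def by (meson rec_eval_Comp2)

lemma computable1_Suc: "computable1 F \<Longrightarrow> computable1 (\<lambda>x. Suc (F x))"
  using computable1_comp[of Suc F] rec_eval.intros(2) unfolding computable1_def by blast

lemma computable1_const: "computable1 (\<lambda>x. c)"
proof (induction c)
  case 0
  show ?case unfolding computable1_def using rec_eval.intros(1) by blast
next
  case (Suc c)
  then show ?case by (rule computable1_Suc)
qed

lemma computable2_add: "computable2 (+)"
proof -
  have "rec_eval (Prec (Proj 0) (Comp Succ [Proj 1])) [x, y] (x + y)" for x y
    by (rule rec_eval_Prec[where F = "\<lambda>x. x + y"])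
      (auto intro!: rec_eval_Comp1 rec_eval_Proj rec_eval.intros(2))
  then show ?thesis unfolding computable2_def by blast
qed

lemmas computable1_add = computable1_comp2[OF computable2_add]

text \<open>The summand depends on the index alone, so primitive recursion without parameters
  suffices; the sums in \<open>triangle_eq_sum\<close> and \<open>instance_number\<close> have this
  form.\<close>

lemma computable1_sum:
  assumes "computable1 F" "computable1 G"
  shows "computable1 (\<lambda>x. \<Sum>i<F x. G i)"
proof -
  obtain add where add: "rec_eval add [x, y] (x + y)" for x y
    using computable2_add unfolding computable2_def by blast
  obtain g where g: "rec_eval g [x] (G x)" for x
    using assms(2) unfolding computable1_def by blast
  let ?h = "Prec Zero (Comp add [Proj 1, Comp g [Proj 0]])"
  have "rec_eval ?h [x] (\<Sum>i<x. G i)" for x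
    by (rule rec_eval_Prec[where F = "\<lambda>x. \<Sum>i<x. G i"])
      (use rec_eval.intros(1)[of "[]"] in
        \<open>auto intro!: rec_eval_Comp2[OF _ _ add] rec_eval_Comp1[OF _ g] rec_eval_Proj\<close>)
  then have "computable1 (\<lambda>x. \<Sum>i<x. G i)" unfolding computable1_def by blast
  from computable1_comp[OF this assms(1)] show ?thesis .
qed

lemma computable1_power2:
  assumes "computable1 F"
  shows "computable1 (\<lambda>x. 2 ^ F x)"
proof -
  obtain add where add: "rec_eval add [x, y] (x + y)" for x y
    using computable2_add unfolding computable2_def by blast
  obtain one where one: "rec_eval one [] 1"
    using rec_eval_Comp1[OF rec_eval.intros(1) rec_eval.intros(2)] by (metis One_nat_def)
  have double: "rec_eval (Comp add [Proj 1, Proj 1]) [i, y] (y + y)" for i y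
    by (rule rec_eval_Comp2[OF _ _ add]) (auto intro: rec_eval_Proj)
  have "rec_eval (Prec one (Comp add [Proj 1, Proj 1])) [x] (2 ^ x)" for x
    by (rule rec_eval_Prec[where F = "\<lambda>x. 2 ^ x"]) (use one double in \<open>auto simp: mult_2\<close>)
  then have "computable1 (\<lambda>x. 2 ^ x)" unfolding computable1_def by blast
  from computable1_comp[OF this assms(1)] show ?thesis .
qed

text \<open>This removes the division from \<open>triangle\<close>, so that
  \<open>prod_encode\<close> is computable by sums and additions.\<close>

lemma triangle_eq_sum: "triangle n = (\<Sum>i<n. Suc i)"
  by (induction n) auto

lemma computable1_prod_encode:
  assumes "computable1 F" "computable1 G"
  shows "computable1 (\<lambda>x. prod_encode (F x, G x))"
  unfolding prod_encode_def triangle_eq_sum prod.case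
  by (intro computable1_add computable1_sum computable1_Suc computable1_id assms)

lemma computable1_list_encode_Cons:
  assumes "computable1 F" "computable1 (\<lambda>x. list_encode (G x))"
  shows "computable1 (\<lambda>x. list_encode (F x # G x))"
  using computable1_Suc[OF computable1_prod_encode[OF assms]] by simp

lemma computable1_list_encode_Nil: "computable1 (\<lambda>x. list_encode [])"
  by (rule computable1_const)

lemmas computable1_intros = computable1_list_encode_Cons computable1_list_encode_Nil
  computable1_prod_encode computable1_power2 computable1_sum computable1_add
  computable1_Suc computable1_id computable1_const


section \<open>Inevitability\<close>

text \<open>The CTL operator AF as a least fixed point. The premise \<open>R c c'\<close> excludes
  deadlocks, where a maximal execution would end without having reached \<open>F\<close>.\<close>

inductive inevitable :: "('c \<Rightarrow> 'c \<Rightarrow> bool) \<Rightarrow> ('c \<Rightarrow> bool) \<Rightarrow> 'c \<Rightarrow> bool" for R F where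
  inevitable_now: "F c \<Longrightarrow> inevitable R F c"
| inevitable_next: "R c c' \<Longrightarrow> (\<And>d. R c d \<Longrightarrow> inevitable R F d) \<Longrightarrow> inevitable R F c"

lemma inevitable_reaches:
  assumes "inevitable (step N v) (\<lambda>c. q \<in> fst ` set c) c"
    and "maximal_execution N v n \<rho> L" "\<rho> k = c" "case L of None \<Rightarrow> True | Some l \<Rightarrow> k \<le> l"
  shows "reaches \<rho> L q"
  using assms(1,3,4)
proof (induction arbitrary: k rule: inevitable.induct)
  case (inevitable_now c)
  then show ?case unfolding reaches_def by blast
next
  case (inevitable_next c c')
  have "case L of None \<Rightarrow> True | Some l \<Rightarrow> k < l"
  proof (cases L)
    case (Some l)
    have "k \<noteq> l"
      using assms(2) Some inevitable_next.hyps(1) inevitable_next.prems(1)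
      by (auto simp: maximal_execution_def)
    with Some inevitable_next.prems(2) show ?thesis by simp
  qed simp
  then have "step N v (\<rho> k) (\<rho> (Suc k))" "case L of None \<Rightarrow> True | Some l \<Rightarrow> Suc k \<le> l"
    using assms(2) by (auto simp: maximal_execution_def split: option.splits)
  then show ?case using inevitable_next by blast
qed

text \<open>Where inevitability fails and a step exists, it fails for some successor as well.
  Following such successors, forever or up to the first deadlock, gives a maximal execution that
  avoids the target.\<close>

lemma all_reach_iff_inevitable:
  "all_reach N v n q \<longleftrightarrow> inevitable (step N v) (\<lambda>c. q \<in> fst ` set c) (initial_config N n)"
proof
  let ?I = "inevitable (step N v) (\<lambda>c. q \<in> fst ` set c)"
  assume all: "all_reach N v n q"
  show "?I (initial_config N n)"
  proof (rule ccontr)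
    assume init: "\<not> ?I (initial_config N n)"
    define nxt where "nxt c = (SOME c'. step N v c c' \<and> \<not> ?I c')" for c
    define \<rho> where "\<rho> k = (nxt ^^ k) (initial_config N n)" for k
    have nxt: "step N v c (nxt c) \<and> \<not> ?I (nxt c)" if "\<not> ?I c" "step N v c c'" for c c'
      unfolding nxt_def
    proof (rule someI_ex, rule ccontr)
      assume "\<nexists>c'. step N v c c' \<and> \<not> ?I c'"
      then have "?I c"
        by - (rule inevitable_next[where R = "step N v" and c = c and c' = c', OF that(2)], blast)
      with that(1) show False ..
    qed
    \<comment> \<open>The execution stops at the first deadlock, if there is one.\<close>
    define L where "L = (if \<forall>k. \<exists>c. step N v (\<rho> k) c then None
      else Some (LEAST k. \<nexists>c. step N v (\<rho> k) c))"
    have \<rho>_0: "\<rho> 0 = initial_config N n" by (simp add: \<rho>_def)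
    have \<rho>_Suc: "\<rho> (Suc k) = nxt (\<rho> k)" for k by (simp add: \<rho>_def)
    have steps: "\<exists>c. step N v (\<rho> k) c" if "case L of None \<Rightarrow> True | Some l \<Rightarrow> k < l" for k
      using that not_less_Least[of k "\<lambda>k. \<nexists>c. step N v (\<rho> k) c"] unfolding L_def
      by (auto split: if_splits)
    have bad: "\<not> ?I (\<rho> k)" if "case L of None \<Rightarrow> True | Some l \<Rightarrow> k \<le> l" for k
      using that
    proof (induction k)
      case 0
      then show ?case using init by (simp add: \<rho>_def)
    next
      case (Suc k)
      have lt: "case L of None \<Rightarrow> True | Some l \<Rightarrow> k < l"
        using Suc.prems by (auto split: option.splits)
      then have "\<not> ?I (\<rho> k)" using Suc.IH by (auto split: option.splits)
      moreover obtain c where "step N v (\<rho> k) c" using steps[OF lt] ..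
      ultimately show ?case unfolding \<rho>_Suc by (rule nxt[THEN conjunct2])
    qed
    have "step N v (\<rho> k) (\<rho> (Suc k))" if lt: "case L of None \<Rightarrow> True | Some l \<Rightarrow> k < l" for k
    proof -
      have "\<not> ?I (\<rho> k)" using that by (intro bad) (auto split: option.splits)
      moreover obtain c where "step N v (\<rho> k) c" using steps[OF lt] ..
      ultimately show ?thesis unfolding \<rho>_Suc by (rule nxt[THEN conjunct1])
    qed
    moreover have "\<nexists>c. step N v (\<rho> l) c" if "L = Some l" for l
    proof -
      have "\<exists>k. \<nexists>c. step N v (\<rho> k) c" "l = (LEAST k. \<nexists>c. step N v (\<rho> k) c)"
        using that unfolding L_def by (auto split: if_splits)
      then show ?thesis using LeastI_ex[of "\<lambda>k. \<nexists>c. step N v (\<rho> k) c"] by simp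
    qed
    ultimately have "maximal_execution N v n \<rho> L"
      unfolding maximal_execution_def using \<rho>_0 by (cases L) auto
    with all have "reaches \<rho> L q" unfolding all_reach_def by blast
    then obtain k where "case L of None \<Rightarrow> True | Some l \<Rightarrow> k \<le> l" "q \<in> fst ` set (\<rho> k)"
      unfolding reaches_def by blast
    from this(2) have "?I (\<rho> k)" by (rule inevitable_now)
    with bad[OF \<open>case L of None \<Rightarrow> True | Some l \<Rightarrow> k \<le> l\<close>] show False ..
  qed
next
  assume inev: "inevitable (step N v) (\<lambda>c. q \<in> fst ` set c) (initial_config N n)"
  show "all_reach N v n q"
    unfolding all_reach_def
  proof (intro allI impI)
    fix \<rho> L
    assume max: "maximal_execution N v n \<rho> L"
    then have "\<rho> 0 = initial_config N n" by (simp add: maximal_execution_def)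
    then show "reaches \<rho> L q"
      by (rule inevitable_reaches[OF inev max]) (simp split: option.split)
  qed
qed

text \<open>Inevitability quantifies over all successors, so each step of \<open>R'\<close> must be
  matched by one of \<open>R\<close>; the last assumption rules out new deadlocks.\<close>

lemma inevitable_transfer:
  assumes "inevitable R F c" "B c d"
    and "\<And>c d. B c d \<Longrightarrow> F c \<Longrightarrow> F' d"
    and "\<And>c d d'. B c d \<Longrightarrow> R' d d' \<Longrightarrow> \<exists>c'. R c c' \<and> B c' d'"
    and "\<And>c c' d. B c d \<Longrightarrow> R c c' \<Longrightarrow> \<exists>d'. R' d d'"
  shows "inevitable R' F' d"
  using assms(1,2)
proof (induction arbitrary: d rule: inevitable.induct)
  case (inevitable_now c)
  then show ?case using assms(3) inevitable.inevitable_now by metis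
next
  case (inevitable_next c c')
  obtain d' where "R' d d'" using assms(5) inevitable_next by blast
  then show ?case
    by (rule inevitable.inevitable_next) (use assms(4) inevitable_next in blast)
qed


section \<open>Broadcast networks as multisets of states\<close>

text \<open>Without clocks, processes differ only in their states, and the clique treats them alike;
  hence multisets. Reception is a function because the protocols used have at most one reception
  target per state and message; ignoring a message is the identity.\<close>

definition mstep ::
  "('s \<times> 'm act \<times> 's) set \<Rightarrow> ('m \<Rightarrow> 's \<Rightarrow> 's) \<Rightarrow> 's multiset \<Rightarrow> 's multiset \<Rightarrow> bool" where
  "mstep T rcv S S' \<longleftrightarrow> (\<exists>q m q'. (q, Bcast m, q') \<in> T \<and> q \<in># S \<and>
     S' = add_mset q' (image_mset (rcv m) (S - {#q#})))"

text \<open>\<open>T\<close> and \<open>rcv\<close> live on structured states and messages, which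
  \<open>num\<close> and \<open>mnum\<close> turn into names. A reception that keeps the state may
  or may not have an edge: non-blocking semantics gives both the same effect.\<close>

locale broadcast_protocol =
  fixes \<N> :: "('q, 'x, 'n, 'p) ptbp"
    and T :: "('s \<times> 'm act \<times> 's) set"
    and rcv :: "'m \<Rightarrow> 's \<Rightarrow> 's"
    and num :: "'s \<Rightarrow> 'q" and mnum :: "'m \<Rightarrow> 'n"
    and s0 :: 's
  assumes wf: "wf_ptbp \<N>"
    and no_clocks: "clocks \<N> = {}"
    and init: "init \<N> = num s0"
    and edges: "edges \<N> = (\<lambda>(q, a, q'). (num q, {}, map_act mnum a, {}, num q')) ` T"
    and inj_num: "inj num" and inj_mnum: "inj mnum"
    and no_internal: "(q, Internal, q') \<notin> T"
    and rcv_eq: "(q, Recv m, q') \<in> T \<Longrightarrow> q' = rcv m q"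
    and rcv_edge: "rcv m q \<noteq> q \<Longrightarrow> (q, Recv m, rcv m q) \<in> T"
begin

definition conf :: "'s list \<Rightarrow> ('q, 'x) config" where
  "conf d = map (\<lambda>q. (num q, \<lambda>x. 0)) d"

lemma takes_iff:
  "takes \<N> v a (num q, \<nu>) s' \<longleftrightarrow>
     (\<exists>b q'. (q, b, q') \<in> T \<and> a = map_act mnum b \<and> s' = (num q', \<nu>))"
proof
  assume "takes \<N> v a (num q, \<nu>) s'"
  then obtain q1 b q' where "(q1, b, q') \<in> T" "a = map_act mnum b" "num q = num q1" "s' = (num q', \<nu>)"
    unfolding takes_def edges by auto
  then show "\<exists>b q'. (q, b, q') \<in> T \<and> a = map_act mnum b \<and> s' = (num q', \<nu>)"
    using injD[OF inj_num] by blast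
next
  assume "\<exists>b q'. (q, b, q') \<in> T \<and> a = map_act mnum b \<and> s' = (num q', \<nu>)"
  then obtain b q' where "(q, b, q') \<in> T" "a = map_act mnum b" "s' = (num q', \<nu>)" by blast
  then show "takes \<N> v a (num q, \<nu>) s'"
    unfolding takes_def edges
    by (intro bexI[of _ "(num q, {}, map_act mnum b, {}, num q')"])
      (auto simp: guard_holds_def intro!: image_eqI[of _ _ "(q, b, q')"])
qed

lemma map_act_eq_iff:
  "map_act mnum a = Recv n \<longleftrightarrow> (\<exists>m. a = Recv m \<and> n = mnum m)"
  "map_act mnum a = Bcast n \<longleftrightarrow> (\<exists>m. a = Bcast m \<and> n = mnum m)"
  "map_act mnum a = Internal \<longleftrightarrow> a = Internal"
  by (cases a; auto)+

lemma takes_Recv_iff: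
  "takes \<N> v (Recv (mnum m)) (num q, \<nu>) s' \<longleftrightarrow> (\<exists>q'. (q, Recv m, q') \<in> T \<and> s' = (num q', \<nu>))"
  unfolding takes_iff by (auto simp: eq_commute[of "Recv _"] map_act_eq_iff inj_eq[OF inj_mnum])

lemma takes_Bcast_iff:
  "takes \<N> v (Bcast n) (num q, \<nu>) s' \<longleftrightarrow>
     (\<exists>m q'. n = mnum m \<and> (q, Bcast m, q') \<in> T \<and> s' = (num q', \<nu>))"
  unfolding takes_iff by (auto simp: eq_commute[of "Bcast _"] map_act_eq_iff)

lemma not_takes_Internal: "\<not> takes \<N> v Internal (num q, \<nu>) s'"
  unfolding takes_iff using no_internal by (auto simp: eq_commute[of "Internal"] map_act_eq_iff)

lemma receives_iff: "receives \<N> v (mnum m) (num q, \<nu>) s' \<longleftrightarrow> s' = (num (rcv m q), \<nu>)"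
  unfolding receives_def takes_Recv_iff using rcv_eq rcv_edge by metis

lemma delay_conf: "map (delay \<N> t) (conf d) = conf d"
  by (simp add: conf_def delay_def no_clocks)

lemma step_conf_iff:
  "step \<N> v (conf d) c \<longleftrightarrow>
     (\<exists>i m q'. i < length d \<and> (d ! i, Bcast m, q') \<in> T \<and> c = conf ((map (rcv m) d)[i := q']))"
  (is "?l \<longleftrightarrow> ?r")
proof -
  have nth: "conf d ! i = (num (d ! i), \<lambda>x. 0)" if "i < length d" for i d
    using that by (simp add: conf_def)
  have len: "length (conf d) = length d" for d by (simp add: conf_def)
  show ?thesis
  proof
    assume ?l
    then obtain i n where i: "i < length d" and n: "takes \<N> v (Bcast n) (conf d ! i) (c ! i)"
      and others: "\<forall>j<length d. j \<noteq> i \<longrightarrow> receives \<N> v n (conf d ! j) (c ! j)"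
      and len_c: "length c = length d"
      unfolding step_def by (auto simp: delay_conf len nth not_takes_Internal)
    from n obtain m q' where m: "n = mnum m" "(d ! i, Bcast m, q') \<in> T" "c ! i = (num q', \<lambda>x. 0)"
      unfolding nth[OF i] takes_Bcast_iff by blast
    have "c = conf ((map (rcv m) d)[i := q'])"
    proof (rule nth_equalityI)
      fix j
      assume "j < length c"
      then show "c ! j = conf ((map (rcv m) d)[i := q']) ! j"
        using others m len_c by (cases "j = i") (simp_all add: nth receives_iff)
    qed (simp add: len len_c)
    with i m(2) show ?r by blast
  next
    assume ?r
    then obtain i m q' where i: "i < length d" "(d ! i, Bcast m, q') \<in> T"
      and c: "c = conf ((map (rcv m) d)[i := q'])" by blast
    have "takes \<N> v (Bcast (mnum m)) (conf d ! i) (c ! i)"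
      using i by (auto simp: c nth takes_Bcast_iff)
    moreover have "receives \<N> v (mnum m) (conf d ! j) (c ! j)" if "j < length d" "j \<noteq> i" for j
      using that by (simp add: c nth receives_iff)
    ultimately show ?l
      unfolding step_def using i by (auto simp: delay_conf len c intro!: exI[of _ "0::real"])
  qed
qed

lemma mset_broadcast:
  assumes "i < length d"
  shows "mset ((map (rcv m) d)[i := q']) = add_mset q' (image_mset (rcv m) (mset d - {#d ! i#}))"
  using assms by (simp add: mset_update image_mset_Diff)

text \<open>Forgetting the order of the processes is a bisimulation, so
  \<open>inevitable_transfer\<close> applies in both directions.\<close>

lemma exists_AF_iff:
  "exists_AF \<N> (num f) \<longleftrightarrow> (\<exists>n. inevitable (mstep T rcv) (\<lambda>S. f \<in># S) (replicate_mset n s0))"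
proof -
  have init: "initial_config \<N> n = conf (replicate n s0)" for n
    by (simp add: initial_config_def conf_def init)
  have F: "num f \<in> fst ` set (conf d) \<longleftrightarrow> f \<in># mset d" for d
    using injD[OF inj_num] by (force simp: conf_def)
  have fwd: "\<exists>d'. c = conf d' \<and> mstep T rcv (mset d) (mset d')" if "step \<N> v (conf d) c" for v d c
  proof -
    from that obtain i m q' where
      i: "i < length d" "(d ! i, Bcast m, q') \<in> T" "c = conf ((map (rcv m) d)[i := q'])"
      unfolding step_conf_iff by blast
    then show ?thesis
      using mset_broadcast[OF i(1), of m q'] nth_mem_mset[OF i(1)] unfolding mstep_def by blast
  qed
  have bwd: "\<exists>d'. S = mset d' \<and> step \<N> v (conf d) (conf d')" if "mstep T rcv (mset d) S" for v d S
  proof -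
    from that obtain q m q' where
      S: "(q, Bcast m, q') \<in> T" "q \<in># mset d"
        "S = add_mset q' (image_mset (rcv m) (mset d - {#q#}))"
      unfolding mstep_def by blast
    \<comment> \<open>Any process in the sender's state may serve as the sender.\<close>
    then obtain i where i: "i < length d" "d ! i = q" by (auto simp: in_set_conv_nth)
    have "step \<N> v (conf d) (conf ((map (rcv m) d)[i := q']))"
      unfolding step_conf_iff using i S(1) by blast
    then show ?thesis
      using S(3) i mset_broadcast[OF i(1), of m q'] by metis
  qed
  have "inevitable (step \<N> v) (\<lambda>c. num f \<in> fst ` set c) (conf d) \<longleftrightarrow>
      inevitable (mstep T rcv) (\<lambda>S. f \<in># S) (mset d)" for v d
  proof
    assume inev: "inevitable (step \<N> v) (\<lambda>c. num f \<in> fst ` set c) (conf d)"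
    show "inevitable (mstep T rcv) (\<lambda>S. f \<in># S) (mset d)"
    proof (rule inevitable_transfer[OF inev, where B = "\<lambda>c S. \<exists>d. c = conf d \<and> S = mset d"])
      show "\<exists>c'. step \<N> v c c' \<and> (\<exists>d. c' = conf d \<and> S' = mset d)"
        if "\<exists>d. c = conf d \<and> S = mset d" "mstep T rcv S S'" for c S S'
        using that bwd by blast
      show "\<exists>S'. mstep T rcv S S'" if "\<exists>d. c = conf d \<and> S = mset d" "step \<N> v c c'" for c S c'
        using that fwd by blast
      show "f \<in># S" if "\<exists>d. c = conf d \<and> S = mset d" "num f \<in> fst ` set c" for c S
        using that F by blast
    qed blast
  next
    assume inev: "inevitable (mstep T rcv) (\<lambda>S. f \<in># S) (mset d)"
    show "inevitable (step \<N> v) (\<lambda>c. num f \<in> fst ` set c) (conf d)"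
    proof (rule inevitable_transfer[OF inev, where B = "\<lambda>S c. \<exists>d. c = conf d \<and> S = mset d"])
      show "\<exists>S'. mstep T rcv S S' \<and> (\<exists>d. c' = conf d \<and> S' = mset d)"
        if "\<exists>d. c = conf d \<and> S = mset d" "step \<N> v c c'" for c S c'
        using that fwd by blast
      show "\<exists>c'. step \<N> v c c'" if "\<exists>d. c = conf d \<and> S = mset d" "mstep T rcv S S'" for c S S'
        using that bwd by blast
      show "num f \<in> fst ` set c" if "\<exists>d. c = conf d \<and> S = mset d" "f \<in># S" for c S
        using that F by blast
    qed blast
  qed
  then show ?thesis
    unfolding exists_AF_clock_free[OF wf no_clocks, where v = "\<lambda>_. 0"] all_reach_iff_inevitable init by simp
qed

end


section \<open>Simulating loop programs by broadcast networks\<close>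

text \<open>The leader is in a state \<open>Ctl k\<close>, and the register \<open>r\<close> is the number of processes in the
  state \<open>Unit r\<close>. The input of the program is loaded by the states \<open>Load i\<close>: the leader waits for
  \<open>i\<close> more processes to move from \<open>Fresh\<close> to \<open>Loaded\<close>.\<close>

datatype st = Initial | Fresh | Loaded | Idle | Unit nat | Sink | Load nat | Ctl prog

datatype msg = Elect | Draw | Go | IncM nat | DecM nat | ZeroM nat | GiveUp

instance instr :: countable by countable_datatype
instance st :: countable by countable_datatype
instance msg :: countable by countable_datatype

section \<open>Control states and registers of a program\<close>

text \<open>An upper bound for the control states met while \<open>p\<close> runs in front of
  \<open>k\<close>, before \<open>k\<close> is reached. A loop body runs in front of the loop that
  contains it; as the recursion is on \<open>p\<close> only, the set is finite.\<close>

fun conts :: "prog \<Rightarrow> prog \<Rightarrow> prog set" where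
  "conts [] k = {}"
| "conts (Inc r # p) k = insert (Inc r # p @ k) (conts p k)"
| "conts (Loop r b # p) k = insert (Loop r b # p @ k) (conts b (Loop r b # p @ k) \<union> conts p k)"

lemma finite_conts: "finite (conts p k)"
  by (induction p k rule: conts.induct) auto

lemma append_in_conts: "p @ k \<in> insert k (conts p k)"
  by (cases p rule: list.exhaust; cases "hd p") auto

lemma conts_Inc: "Inc r # x \<in> conts p k \<Longrightarrow> x \<in> insert k (conts p k)"
  by (induction p k rule: conts.induct) (use append_in_conts in auto)

lemma conts_Loop:
  "Loop r b # x \<in> conts p k \<Longrightarrow> x \<in> insert k (conts p k) \<and> b @ Loop r b # x \<in> insert k (conts p k)"
  by (induction p k rule: conts.induct) (use append_in_conts in auto)

definition ctl :: "prog \<Rightarrow> prog set" where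
  "ctl P = insert [] (conts P [])"

lemma finite_ctl: "finite (ctl P)"
  by (simp add: ctl_def finite_conts)

lemma self_in_ctl: "P \<in> ctl P"
  using append_in_conts[of P "[]"] by (simp add: ctl_def)

lemma ctl_Inc: "Inc r # k \<in> ctl P \<Longrightarrow> k \<in> ctl P"
  using conts_Inc by (auto simp: ctl_def)

lemma ctl_Loop: "Loop r b # k \<in> ctl P \<Longrightarrow> k \<in> ctl P \<and> b @ Loop r b # k \<in> ctl P"
  using conts_Loop[of r b k P "[]"] by (auto simp: ctl_def)

lemma runs_ctl: "runs (k, s) (k', s') \<Longrightarrow> k \<in> ctl P \<Longrightarrow> k' \<in> ctl P"
  by (induction rule: rtranclp_induct2) (auto elim!: run1.cases dest: ctl_Inc ctl_Loop)

fun reg :: "instr \<Rightarrow> nat" where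
  "reg (Inc r) = r"
| "reg (Loop r b) = r"

text \<open>Register 0 is added because it receives the input. The control state \<open>[]\<close>
  contributes an unspecified register, which only adds harmless states and messages.\<close>

definition regs :: "prog \<Rightarrow> nat set" where
  "regs P = insert 0 ((\<lambda>k. reg (hd k)) ` ctl P)"

lemma finite_regs: "finite (regs P)"
  by (simp add: regs_def finite_ctl)

lemma zero_in_regs: "0 \<in> regs P"
  by (simp add: regs_def)

lemma regs_Inc: "Inc r # k \<in> ctl P \<Longrightarrow> r \<in> regs P"
  unfolding regs_def by (intro insertI2 image_eqI[of _ _ "Inc r # k"]) auto

lemma regs_Loop: "Loop r b # k \<in> ctl P \<Longrightarrow> r \<in> regs P"
  unfolding regs_def by (intro insertI2 image_eqI[of _ _ "Loop r b # k"]) auto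

text \<open>An announcement that the current instruction does not call for leads to
  \<open>[]\<close>, and thus to the target state.\<close>

fun after_inc :: "nat \<Rightarrow> prog \<Rightarrow> prog" where
  "after_inc r (Inc r' # k) = (if r' = r then k else [])"
| "after_inc r k = []"

fun after_dec :: "nat \<Rightarrow> prog \<Rightarrow> prog" where
  "after_dec r (Loop r' b # k) = (if r' = r then b @ Loop r' b # k else [])"
| "after_dec r k = []"

text \<open>The target state \<open>Ctl []\<close> is also entered whenever a message reveals that the sender has
  deviated from the run of the program. Thus all deviations are harmless.\<close>

fun react :: "msg \<Rightarrow> st \<Rightarrow> st" where
  "react Elect q = (if q = Initial then Fresh else q)"
| "react Draw q = (case q of Load i \<Rightarrow> (case i of 0 \<Rightarrow> Ctl [] | Suc j \<Rightarrow> Load j) | _ \<Rightarrow> q)"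
| "react Go q = (if q = Fresh then Idle else if q = Loaded then Unit 0 else q)"
| "react (IncM r) q = (case q of Ctl k \<Rightarrow> Ctl (after_inc r k) | _ \<Rightarrow> q)"
| "react (DecM r) q = (case q of Ctl k \<Rightarrow> Ctl (after_dec r k) | _ \<Rightarrow> q)"
| "react (ZeroM r) q = (if q = Unit r then Ctl [] else q)"
| "react GiveUp q = (if q = Idle then Ctl [] else q)"

text \<open>\<open>Load (Suc i)\<close> is missing on purpose: its edges depend on the input and are
  added only in \<open>transitions\<close>, which keeps \<open>base P\<close> independent of
  it.\<close>

definition reactive :: "prog \<Rightarrow> (st \<times> msg) set" where
  "reactive P = ({Initial, Fresh, Loaded, Idle, Load 0} \<union> Unit ` regs P \<union> Ctl ` ctl P) \<times>
     ({Elect, Draw, Go, GiveUp} \<union> IncM ` regs P \<union> DecM ` regs P \<union> ZeroM ` regs P)"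

text \<open>Without an idle process, an increment is impossible. Then the leader may give up and
  loop in \<open>Sink\<close>.\<close>

fun lead :: "prog \<Rightarrow> (st \<times> msg act \<times> st) set" where
  "lead [] = {}"
| "lead (Inc r # k) = {(Ctl (Inc r # k), Bcast GiveUp, Sink)}"
| "lead (Loop r b # k) = {(Ctl (Loop r b # k), Bcast (ZeroM r), Ctl k)}"

definition base :: "prog \<Rightarrow> (st \<times> msg act \<times> st) set" where
  "base P = (\<lambda>(q, m). (q, Recv m, react m q)) ` reactive P \<union>
     {(Fresh, Bcast Draw, Loaded), (Load 0, Bcast Go, Ctl P), (Sink, Bcast GiveUp, Sink)} \<union>
     (\<lambda>r. (Idle, Bcast (IncM r), Unit r)) ` regs P \<union>
     (\<lambda>r. (Unit r, Bcast (DecM r), Idle)) ` regs P \<union> (\<Union>k \<in> ctl P. lead k)"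

definition transitions :: "prog \<Rightarrow> nat \<Rightarrow> (st \<times> msg act \<times> st) set" where
  "transitions P E = base P \<union>
     insert (Initial, Bcast Elect, Load E) ((\<lambda>i. (Load (Suc i), Recv Draw, Load i)) ` {..<E})"

definition rcv :: "prog \<Rightarrow> nat \<Rightarrow> msg \<Rightarrow> st \<Rightarrow> st" where
  "rcv P E m q = (if (q, m) \<in> reactive P \<union> (\<lambda>i. (Load (Suc i), Draw)) ` {..<E} then react m q else q)"

lemma finite_base: "finite (base P)"
proof -
  have "finite (lead k)" for k by (cases k rule: lead.cases) auto
  then show ?thesis
    by (simp add: base_def reactive_def finite_ctl finite_regs)
qed

lemma in_lead_iff:
  "e \<in> lead k \<longleftrightarrow> (\<exists>r k'. k = Inc r # k' \<and> e = (Ctl k, Bcast GiveUp, Sink)) \<or>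
     (\<exists>r b k'. k = Loop r b # k' \<and> e = (Ctl k, Bcast (ZeroM r), Ctl k'))"
  by (cases k rule: lead.cases) auto

lemma Internal_notin_transitions: "(q, Internal, q') \<notin> transitions P E"
  by (auto simp: transitions_def base_def in_lead_iff)

lemma Recv_transitions: "(q, Recv m, q') \<in> transitions P E \<Longrightarrow> q' = rcv P E m q"
  by (auto simp: transitions_def base_def in_lead_iff rcv_def)

lemma rcv_transitions: "rcv P E m q \<noteq> q \<Longrightarrow> (q, Recv m, rcv P E m q) \<in> transitions P E"
  by (auto simp: transitions_def base_def rcv_def split: if_splits)

lemma image_mset_fixed: "(\<And>x. x \<in># M \<Longrightarrow> f x = x) \<Longrightarrow> image_mset f M = M"
  by (induction M) auto

section \<open>Moves of the simulating network\<close>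

context
  fixes P :: prog and E :: nat
begin

abbreviation "T \<equiv> transitions P E"
abbreviation "R \<equiv> rcv P E"
abbreviation "moves \<equiv> mstep T R"
abbreviation "wins \<equiv> inevitable moves (\<lambda>S. Ctl [] \<in># S)"

lemma Bcast_transitions_iff:
  "(q, Bcast m, q') \<in> T \<longleftrightarrow>
     q = Initial \<and> m = Elect \<and> q' = Load E \<or> q = Fresh \<and> m = Draw \<and> q' = Loaded \<or>
     q = Load 0 \<and> m = Go \<and> q' = Ctl P \<or> q = Sink \<and> m = GiveUp \<and> q' = Sink \<or>
     (\<exists>r \<in> regs P. q = Idle \<and> m = IncM r \<and> q' = Unit r) \<or>
     (\<exists>r \<in> regs P. q = Unit r \<and> m = DecM r \<and> q' = Idle) \<or>
     (\<exists>r k. Inc r # k \<in> ctl P \<and> q = Ctl (Inc r # k) \<and> m = GiveUp \<and> q' = Sink) \<or>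
     (\<exists>r b k. Loop r b # k \<in> ctl P \<and> q = Ctl (Loop r b # k) \<and> m = ZeroM r \<and> q' = Ctl k)"
proof -
  have "(\<exists>k \<in> ctl P. (q, Bcast m, q') \<in> lead k) \<longleftrightarrow>
      (\<exists>r k. Inc r # k \<in> ctl P \<and> q = Ctl (Inc r # k) \<and> m = GiveUp \<and> q' = Sink) \<or>
      (\<exists>r b k. Loop r b # k \<in> ctl P \<and> q = Ctl (Loop r b # k) \<and> m = ZeroM r \<and> q' = Ctl k)" (is "_ \<longleftrightarrow> ?inc \<or> ?loop")
  proof
    assume "\<exists>k \<in> ctl P. (q, Bcast m, q') \<in> lead k"
    then obtain k where "k \<in> ctl P" "(q, Bcast m, q') \<in> lead k" ..
    then show "?inc \<or> ?loop" by (cases k rule: lead.cases) simp_all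
  next
    assume "?inc \<or> ?loop"
    then show "\<exists>k \<in> ctl P. (q, Bcast m, q') \<in> lead k"
    proof (elim disjE exE conjE)
      fix r k assume "Inc r # k \<in> ctl P" "q = Ctl (Inc r # k)" "m = GiveUp" "q' = Sink"
      then show ?thesis by (intro bexI[of _ "Inc r # k"]) simp_all
    next
      fix r b k
      assume "Loop r b # k \<in> ctl P" "q = Ctl (Loop r b # k)" "m = ZeroM r" "q' = Ctl k"
      then show ?thesis by (intro bexI[of _ "Loop r b # k"]) simp_all
    qed
  qed
  moreover have "(q, Bcast m, q') \<notin> (\<lambda>(q, m). (q, Recv m, react m q)) ` reactive P"
    "(q, Bcast m, q') \<notin> (\<lambda>i. (Load (Suc i), Recv Draw, Load i)) ` {..<E}" by auto
  ultimately show ?thesis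
    unfolding transitions_def base_def Un_iff insert_iff UN_iff image_iff prod.inject act.inject
      empty_iff by (simp only: simp_thms) blast
qed

lemma rcv_simps:
  "R Elect Initial = Fresh" "R Draw Fresh = Fresh" "R Draw Loaded = Loaded"
  "R Draw (Load 0) = Ctl []" "i < E \<Longrightarrow> R Draw (Load (Suc i)) = Load i"
  "R Go Fresh = Idle" "R Go Loaded = Unit 0"
  "k \<in> ctl P \<Longrightarrow> r \<in> regs P \<Longrightarrow> R (IncM r) (Ctl k) = Ctl (after_inc r k)"
  "k \<in> ctl P \<Longrightarrow> r \<in> regs P \<Longrightarrow> R (DecM r) (Ctl k) = Ctl (after_dec r k)"
  "R GiveUp Idle = Ctl []" "r \<in> regs P \<Longrightarrow> R (ZeroM r) (Unit r) = Ctl []"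
  "R (IncM r) Idle = Idle" "R (IncM r) (Unit r') = Unit r'"
  "R (DecM r) Idle = Idle" "R (DecM r) (Unit r') = Unit r'"
  "R (ZeroM r) Idle = Idle" "r \<noteq> r' \<Longrightarrow> R (ZeroM r) (Unit r') = Unit r'"
  "R GiveUp (Unit r') = Unit r'"
  by (auto simp: rcv_def reactive_def)

definition crowd :: "st multiset \<Rightarrow> bool" where
  "crowd M \<longleftrightarrow> set_mset M \<subseteq> insert Idle (Unit ` regs P)"

text \<open>The number of processes in \<open>Idle\<close> is left open: they are the reserve from
  which counters are increased.\<close>

definition holds :: "st multiset \<Rightarrow> store \<Rightarrow> bool" where
  "holds M s \<longleftrightarrow> crowd M \<and> (\<forall>r. count M (Unit r) = s r)"

text \<open>Within the crowd only \<open>ZeroM r\<close> and \<open>GiveUp\<close> have an effect,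
  and only if the leader's claim is false because some \<open>Unit r\<close>, respectively
  \<open>Idle\<close>, is present.\<close>

lemma crowd_fixed:
  assumes "crowd M"
  shows "image_mset (R (IncM r)) M = M" "image_mset (R (DecM r)) M = M"
    "Unit r \<notin># M \<Longrightarrow> image_mset (R (ZeroM r)) M = M"
    "Idle \<notin># M \<Longrightarrow> image_mset (R GiveUp) M = M"
proof -
  have cases: "x = Idle \<or> (\<exists>r. x = Unit r)" if "x \<in># M" for x
    using assms that by (auto simp: crowd_def)
  show "image_mset (R (IncM r)) M = M" "image_mset (R (DecM r)) M = M"
    by (rule image_mset_fixed; use cases rcv_simps(12-15) in metis)+
  show "image_mset (R (ZeroM r)) M = M" if "Unit r \<notin># M"
    by (rule image_mset_fixed) (use cases that rcv_simps(16,17) in metis)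
  show "image_mset (R GiveUp) M = M" if "Idle \<notin># M"
    by (rule image_mset_fixed) (use cases that rcv_simps(18) in metis)
qed

lemma crowd_diff: "crowd M \<Longrightarrow> crowd (M - N)"
  unfolding crowd_def by (meson in_diffD subset_iff)

text \<open>One disjunct per kind of broadcast edge. Counter changes are started by the crowd and
  judged by the leader through \<open>after_inc\<close> and \<open>after_dec\<close>; giving up and
  zero tests are started by the leader and judged by the crowd.\<close>

lemma moves_Ctl_iff:
  assumes k: "k \<in> ctl P" and M: "crowd M"
  shows "moves (add_mset (Ctl k) M) S \<longleftrightarrow>
     (\<exists>r \<in> regs P. Idle \<in># M \<and>
        S = add_mset (Unit r) (add_mset (Ctl (after_inc r k)) (M - {#Idle#}))) \<or>
     (\<exists>r. Unit r \<in># M \<and>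
        S = add_mset Idle (add_mset (Ctl (after_dec r k)) (M - {#Unit r#}))) \<or>
     (\<exists>r k'. k = Inc r # k' \<and> S = add_mset Sink (image_mset (R GiveUp) M)) \<or>
     (\<exists>r b k'. k = Loop r b # k' \<and> S = add_mset (Ctl k') (image_mset (R (ZeroM r)) M))"
proof -
  have regs: "r \<in> regs P" if "Unit r \<in># M" for r
    using M that by (auto simp: crowd_def)
  have others: "Initial \<notin># M" "Fresh \<notin># M" "Load i \<notin># M" "Sink \<notin># M" "Ctl k' \<notin># M" for i k'
    using M by (auto simp: crowd_def)
  have inc: "add_mset (Unit r) (image_mset (R (IncM r)) (add_mset (Ctl k) M - {#Idle#})) =
      add_mset (Unit r) (add_mset (Ctl (after_inc r k)) (M - {#Idle#}))" if "r \<in> regs P" for r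
    using k that M by (simp add: rcv_simps crowd_fixed crowd_diff)
  have dec: "add_mset Idle (image_mset (R (DecM r)) (add_mset (Ctl k) M - {#Unit r#})) =
      add_mset Idle (add_mset (Ctl (after_dec r k)) (M - {#Unit r#}))" if "r \<in> regs P" for r
    using k that M by (simp add: rcv_simps crowd_fixed crowd_diff)
  show ?thesis
  proof
    assume "moves (add_mset (Ctl k) M) S"
    then obtain q m q' where q: "(q, Bcast m, q') \<in> T" "q \<in># add_mset (Ctl k) M"
      "S = add_mset q' (image_mset (R m) (add_mset (Ctl k) M - {#q#}))"
      unfolding mstep_def by blast
    show "(\<exists>r \<in> regs P. Idle \<in># M \<and>
        S = add_mset (Unit r) (add_mset (Ctl (after_inc r k)) (M - {#Idle#}))) \<or>
     (\<exists>r. Unit r \<in># M \<and>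
        S = add_mset Idle (add_mset (Ctl (after_dec r k)) (M - {#Unit r#}))) \<or>
     (\<exists>r k'. k = Inc r # k' \<and> S = add_mset Sink (image_mset (R GiveUp) M)) \<or>
     (\<exists>r b k'. k = Loop r b # k' \<and> S = add_mset (Ctl k') (image_mset (R (ZeroM r)) M))"
      using q(1) unfolding Bcast_transitions_iff
    proof (elim disjE exE conjE bexE)
      fix r assume "r \<in> regs P" "q = Idle" "m = IncM r" "q' = Unit r"
      then show ?thesis using q(2,3) inc by auto
    next
      fix r assume "r \<in> regs P" "q = Unit r" "m = DecM r" "q' = Idle"
      then show ?thesis using q(2,3) dec by auto
    qed (use q(2,3) others in auto)
  next
    assume "(\<exists>r \<in> regs P. Idle \<in># M \<and>
        S = add_mset (Unit r) (add_mset (Ctl (after_inc r k)) (M - {#Idle#}))) \<or>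
     (\<exists>r. Unit r \<in># M \<and>
        S = add_mset Idle (add_mset (Ctl (after_dec r k)) (M - {#Unit r#}))) \<or>
     (\<exists>r k'. k = Inc r # k' \<and> S = add_mset Sink (image_mset (R GiveUp) M)) \<or>
     (\<exists>r b k'. k = Loop r b # k' \<and> S = add_mset (Ctl k') (image_mset (R (ZeroM r)) M))"
    then show "moves (add_mset (Ctl k) M) S"
    proof (elim disjE exE conjE bexE)
      fix r assume r: "r \<in> regs P" "Idle \<in># M"
        "S = add_mset (Unit r) (add_mset (Ctl (after_inc r k)) (M - {#Idle#}))"
      then show ?thesis
        unfolding mstep_def using inc[OF r(1)]
        by (intro exI[of _ Idle] exI[of _ "IncM r"] exI[of _ "Unit r"]) (auto simp: Bcast_transitions_iff)
    next
      fix r assume r: "Unit r \<in># M"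
        "S = add_mset Idle (add_mset (Ctl (after_dec r k)) (M - {#Unit r#}))"
      then show ?thesis
        unfolding mstep_def using dec[OF regs[OF r(1)]] regs[OF r(1)]
        by (intro exI[of _ "Unit r"] exI[of _ "DecM r"] exI[of _ Idle]) (auto simp: Bcast_transitions_iff)
    next
      fix r k' assume "k = Inc r # k'" "S = add_mset Sink (image_mset (R GiveUp) M)"
      then show ?thesis
        unfolding mstep_def using k
        by (intro exI[of _ "Ctl k"] exI[of _ GiveUp] exI[of _ Sink]) (auto simp: Bcast_transitions_iff)
    next
      fix r b k' assume "k = Loop r b # k'" "S = add_mset (Ctl k') (image_mset (R (ZeroM r)) M)"
      then show ?thesis
        unfolding mstep_def using k
        by (intro exI[of _ "Ctl k"] exI[of _ "ZeroM r"] exI[of _ "Ctl k'"])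
          (auto simp: Bcast_transitions_iff)
    qed
  qed
qed

text \<open>The first broadcast moves all other processes to \<open>Fresh\<close>, so exactly one
  leader is elected.\<close>

lemma moves_Initial_iff:
  "moves (replicate_mset n Initial) S \<longleftrightarrow>
     n > 0 \<and> S = add_mset (Load E) (replicate_mset (n - 1) Fresh)"
proof -
  have "moves (replicate_mset n Initial) S \<longleftrightarrow>
      n > 0 \<and> S = add_mset (Load E) (image_mset (R Elect) (replicate_mset n Initial - {#Initial#}))"
    unfolding mstep_def Bcast_transitions_iff by auto
  also have "\<dots> \<longleftrightarrow> n > 0 \<and> S = add_mset (Load E) (replicate_mset (n - 1) Fresh)"
    by (cases n) (auto simp: rcv_simps)
  finally show ?thesis .
qed

abbreviation loading :: "nat \<Rightarrow> nat \<Rightarrow> nat \<Rightarrow> st multiset" where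
  "loading j a b \<equiv> add_mset (Load j) (replicate_mset a Fresh + replicate_mset b Loaded)"

text \<open>\<open>Go\<close> is possible only at \<open>Load 0\<close>, where a further
  \<open>Draw\<close> would send the leader to \<open>Ctl []\<close>. So if the program starts and
  the target has been avoided, exactly \<open>E\<close> processes are loaded.\<close>

lemma moves_loading_iff:
  assumes "j \<le> E"
  shows "moves (loading j a b) S \<longleftrightarrow>
     (\<exists>a'. a = Suc a' \<and>
        S = add_mset (R Draw (Load j)) (replicate_mset a' Fresh + replicate_mset (Suc b) Loaded)) \<or>
     (j = 0 \<and> S = add_mset (Ctl P) (replicate_mset a Idle + replicate_mset b (Unit 0)))"
proof -
  have "moves (loading j a b) S \<longleftrightarrow>
      (a > 0 \<and> S = add_mset Loaded (image_mset (R Draw) (loading j a b - {#Fresh#}))) \<or>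
      (j = 0 \<and> S = add_mset (Ctl P) (image_mset (R Go) (loading j a b - {#Load 0#})))"
      (is "_ \<longleftrightarrow> ?draw \<or> ?go")
  proof
    assume "moves (loading j a b) S"
    then obtain q m q' where q: "(q, Bcast m, q') \<in> T" "q \<in># loading j a b"
      "S = add_mset q' (image_mset (R m) (loading j a b - {#q#}))"
      unfolding mstep_def by blast
    from q(2) have "q = Load j \<or> q = Fresh \<and> a > 0 \<or> q = Loaded" by (auto split: if_splits)
    with q(1,3) show "?draw \<or> ?go" unfolding Bcast_transitions_iff by auto
  next
    assume "?draw \<or> ?go"
    then show "moves (loading j a b) S"
    proof
      assume ?draw
      then show ?thesis
        unfolding mstep_def
        by (intro exI[of _ Fresh] exI[of _ Draw] exI[of _ Loaded]) (auto simp: Bcast_transitions_iff)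
    next
      assume ?go
      then show ?thesis
        unfolding mstep_def
        by (intro exI[of _ "Load 0"] exI[of _ Go] exI[of _ "Ctl P"]) (auto simp: Bcast_transitions_iff)
    qed
  qed
  also have "\<dots> \<longleftrightarrow> (\<exists>a'. a = Suc a' \<and>
        S = add_mset (R Draw (Load j)) (replicate_mset a' Fresh + replicate_mset (Suc b) Loaded)) \<or>
     (j = 0 \<and> S = add_mset (Ctl P) (replicate_mset a Idle + replicate_mset b (Unit 0)))"
    by (cases a) (auto simp: rcv_simps add_mset_commute)
  finally show ?thesis .
qed

section \<open>Halting programs: the target is unavoidable in a large enough network\<close>

lemma wins_now: "Ctl [] \<in># S \<Longrightarrow> wins S"
  by (rule inevitable_now)

lemma wins_next: "moves S S' \<Longrightarrow> (\<And>S'. moves S S' \<Longrightarrow> wins S') \<Longrightarrow> wins S"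
  by (rule inevitable_next[where R = moves])

lemma holds_simps:
  "holds M s \<Longrightarrow> r \<in> regs P \<Longrightarrow> holds (add_mset (Unit r) (M - {#Idle#})) (s(r := Suc (s r)))"
  "holds M s \<Longrightarrow> s r = Suc n \<Longrightarrow> holds (add_mset Idle (M - {#Unit r#})) (s(r := n))"
  by (auto simp: holds_def crowd_def dest: in_diffD)

lemma holds_Unit_iff: "holds M s \<Longrightarrow> Unit r \<in># M \<longleftrightarrow> s r > 0"
  by (metis count_greater_zero_iff holds_def)

text \<open>Induction along the run. While idle processes remain, every move other than the next
  step of the run puts some process into \<open>Ctl []\<close>, and a step uses up at most one idle
  process.\<close>

lemma wins_if_halts:
  assumes "runs (k, s) ([], t)" "k \<in> ctl P"
  shows "\<exists>W. \<forall>M. holds M s \<and> W \<le> count M Idle \<longrightarrow> wins (add_mset (Ctl k) M)"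
  using assms
proof (induction rule: converse_rtranclp_induct2)
  case refl
  have "wins (add_mset (Ctl []) M)" for M by (rule wins_now) simp
  then show ?case by blast
next
  case (step k s k' s')
  have "k' \<in> ctl P"
    using runs_ctl[of k s k' s'] step.hyps(1) step.prems by blast
  then obtain W where W: "\<And>M. holds M s' \<Longrightarrow> W \<le> count M Idle \<Longrightarrow> wins (add_mset (Ctl k') M)"
    using step.IH by blast
  \<comment> \<open>One idle process more than the rest of the run needs: it serves a possible
    increment, and it punishes giving up.\<close>
  have "wins (add_mset (Ctl k) M)" if M: "holds M s" "Suc W \<le> count M Idle" for M
  proof -
    note iff = moves_Ctl_iff[OF step.prems, of M]
    have crowd: "crowd M" using M(1) by (simp add: holds_def)
    have idle: "Idle \<in># M" using M(2) by (metis Suc_le_D count_inI nat.distinct(1))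
    have giveup: "Ctl [] \<in># image_mset (R GiveUp) M"
      using idle rcv_simps(10) by (metis image_eqI set_image_mset)
    show ?thesis
      using step.hyps(1)
    proof cases
      case (run1_Inc r)
      then have r: "r \<in> regs P" using regs_Inc step.prems by blast
      show ?thesis
      proof (rule wins_next)
        show "moves (add_mset (Ctl k) M)
            (add_mset (Unit r) (add_mset (Ctl (after_inc r k)) (M - {#Idle#})))"
          unfolding iff[OF crowd] using r idle by blast
      next
        fix S
        assume "moves (add_mset (Ctl k) M) S"
        then show "wins S"
          unfolding iff[OF crowd]
        proof (elim disjE exE conjE bexE)
          fix r' assume S: "S = add_mset (Unit r') (add_mset (Ctl (after_inc r' k)) (M - {#Idle#}))"
          show ?thesis
          proof (cases "r' = r")
            case True
            have "wins (add_mset (Ctl k') (add_mset (Unit r) (M - {#Idle#})))"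
              using M r holds_simps(1) run1_Inc(2) by (intro W) auto
            then show ?thesis using S True run1_Inc(1) by (simp add: add_mset_commute)
          next
            case False
            then show ?thesis using S run1_Inc(1) by (intro wins_now) simp
          qed
        next
          fix r' assume "S = add_mset Idle (add_mset (Ctl (after_dec r' k)) (M - {#Unit r'#}))"
          then show ?thesis using run1_Inc(1) by (intro wins_now) simp
        next
          fix r' k' assume "S = add_mset Sink (image_mset (R GiveUp) M)"
          then show ?thesis using giveup by (intro wins_now) simp
        next
          fix r' b k' assume "k = Loop r' b # k'"
          then show ?thesis using run1_Inc(1) by simp
        qed
      qed
    next
      case (run1_Loop r n b k0)
      then have r: "r \<in> regs P" using regs_Loop step.prems by blast
      have unit: "Unit r \<in># M" using holds_Unit_iff[OF M(1)] run1_Loop(4) by simp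
      have zero: "Ctl [] \<in># image_mset (R (ZeroM r)) M"
        using unit rcv_simps(11)[OF r] by (metis image_eqI set_image_mset)
      show ?thesis
      proof (rule wins_next)
        show "moves (add_mset (Ctl k) M) (add_mset Idle (add_mset (Ctl (after_dec r k)) (M - {#Unit r#})))"
          unfolding iff[OF crowd] using unit by blast
      next
        fix S
        assume "moves (add_mset (Ctl k) M) S"
        then show "wins S"
          unfolding iff[OF crowd]
        proof (elim disjE exE conjE bexE)
          fix r' assume "S = add_mset (Unit r') (add_mset (Ctl (after_inc r' k)) (M - {#Idle#}))"
          then show ?thesis using run1_Loop(1) by (intro wins_now) simp
        next
          fix r' assume S: "S = add_mset Idle (add_mset (Ctl (after_dec r' k)) (M - {#Unit r'#}))"
          show ?thesis
          proof (cases "r' = r")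
            case True
            have "wins (add_mset (Ctl k') (add_mset Idle (M - {#Unit r#})))"
              using M holds_simps(2)[OF M(1) run1_Loop(4)] run1_Loop(3) by (intro W) auto
            then show ?thesis using S True run1_Loop(1,2) by (simp add: add_mset_commute)
          next
            case False
            then show ?thesis using S run1_Loop(1) by (intro wins_now) simp
          qed
        next
          fix r' k' assume "k = Inc r' # k'"
          then show ?thesis using run1_Loop(1) by simp
        next
          fix r' b' k1 assume "k = Loop r' b' # k1" "S = add_mset (Ctl k1) (image_mset (R (ZeroM r')) M)"
          then show ?thesis using zero run1_Loop(1) by (intro wins_now) simp
        qed
      qed
    next
      case (run1_exit r b)
      have unit: "Unit r \<notin># M" using holds_Unit_iff[OF M(1)] run1_exit(3) by simp
      have fixed: "image_mset (R (ZeroM r)) M = M" using crowd_fixed(3)[OF crowd unit] .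
      show ?thesis
      proof (rule wins_next)
        show "moves (add_mset (Ctl k) M) (add_mset (Ctl k') (image_mset (R (ZeroM r)) M))"
          unfolding iff[OF crowd] using run1_exit(1) by blast
      next
        fix S
        assume "moves (add_mset (Ctl k) M) S"
        then show "wins S"
          unfolding iff[OF crowd]
        proof (elim disjE exE conjE bexE)
          fix r' assume "S = add_mset (Unit r') (add_mset (Ctl (after_inc r' k)) (M - {#Idle#}))"
          then show ?thesis using run1_exit(1) by (intro wins_now) simp
        next
          fix r' assume "Unit r' \<in># M"
            "S = add_mset Idle (add_mset (Ctl (after_dec r' k)) (M - {#Unit r'#}))"
          then show ?thesis using run1_exit(1) unit by (intro wins_now) auto
        next
          fix r' k' assume "k = Inc r' # k'"
          then show ?thesis using run1_exit(1) by simp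
        next
          fix r' b' k1 assume "k = Loop r' b' # k1" "S = add_mset (Ctl k1) (image_mset (R (ZeroM r')) M)"
          then show ?thesis using run1_exit(1,2) fixed W[of M] M by simp
        qed
      qed
    qed
  qed
  then show ?case by blast
qed

lemma holds_loaded:
  "holds (replicate_mset a Idle + replicate_mset b (Unit 0)) ((\<lambda>_. 0)(0 := b))"
  using zero_in_regs by (auto simp: holds_def crowd_def split: if_splits)

lemma wins_initial_if_halts:
  assumes "runs (P, (\<lambda>_. 0)(0 := E)) ([], t)"
  shows "\<exists>n. wins (replicate_mset n Initial)"
proof -
  obtain W where W: "\<And>M. holds M ((\<lambda>_. 0)(0 := E)) \<Longrightarrow> W \<le> count M Idle \<Longrightarrow> wins (add_mset (Ctl P) M)"
    using wins_if_halts[OF assms self_in_ctl] by blast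
  \<comment> \<open>With \<open>j\<close> processes still to be drawn, \<open>j + W\<close> are
    fresh, so that \<open>W\<close> become idle when the program starts.\<close>
  have load: "wins (loading j (j + W) (E - j))" if "j \<le> E" for j
    using that
  proof (induction j)
    case 0
    let ?M = "replicate_mset W Idle + replicate_mset E (Unit 0)"
    show ?case
    proof (rule wins_next)
      show "moves (loading 0 (0 + W) (E - 0)) (add_mset (Ctl P) ?M)"
        by (simp add: moves_loading_iff)
    next
      fix S assume "moves (loading 0 (0 + W) (E - 0)) S"
      then have "Ctl [] \<in># S \<or> S = add_mset (Ctl P) ?M"
        by (auto simp: moves_loading_iff rcv_simps(4))
      then show "wins S"
      proof
        assume "Ctl [] \<in># S"
        then show ?thesis by (rule wins_now)
      next
        assume "S = add_mset (Ctl P) ?M"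
        then show ?thesis using W[of ?M] holds_loaded by simp
      qed
    qed
  next
    case (Suc j)
    have "replicate_mset (Suc (E - Suc j)) Loaded = replicate_mset (E - j) Loaded"
      using Suc.prems by (simp add: Suc_diff_Suc)
    then have iff: "moves (loading (Suc j) (Suc j + W) (E - Suc j)) S \<longleftrightarrow> S = loading j (j + W) (E - j)"
      for S
      using Suc.prems moves_loading_iff[of "Suc j" "Suc j + W" "E - Suc j" S] rcv_simps(5)[of j]
      by simp
    show ?case by (rule wins_next) (use iff Suc in auto)
  qed
  \<comment> \<open>One leader, \<open>E\<close> units of input and \<open>W\<close> idle
    processes.\<close>
  have "wins (replicate_mset (Suc (E + W)) Initial)"
  proof (rule wins_next)
    show "moves (replicate_mset (Suc (E + W)) Initial) (loading E (E + W) 0)"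
      by (subst moves_Initial_iff) simp
  next
    fix S assume "moves (replicate_mset (Suc (E + W)) Initial) S"
    then have "S = loading E (E + W) 0" unfolding moves_Initial_iff by simp
    then show "wins S" using load[of E] by simp
  qed
  then show ?thesis ..
qed

section \<open>Diverging programs: the target can be avoided in every network\<close>

text \<open>An invariant with four phases: before the election, loading, faithful simulation, and
  the endless loop of a leader that gave up with no idle process left.\<close>

inductive evading :: "st multiset \<Rightarrow> bool" where
  "evading (replicate_mset n Initial)"
| "j \<le> E \<Longrightarrow> evading (loading j a (E - j))"
| "runs (P, (\<lambda>_. 0)(0 := E)) (k, s) \<Longrightarrow> holds M s \<Longrightarrow> evading (add_mset (Ctl k) M)"
| "crowd M \<Longrightarrow> Idle \<notin># M \<Longrightarrow> evading (add_mset Sink M)"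

text \<open>The honest move stays evading; at an increment without idle processes this is
  \<open>GiveUp\<close>. The premise \<open>moves S S'\<close> sets aside deadlocks, such as an
  empty network or loading with too few processes, where the execution ends short of the
  target.\<close>

lemma evading_moves:
  assumes "evading S" "moves S S'" and diverges: "\<And>t. \<not> runs (P, (\<lambda>_. 0)(0 := E)) ([], t)"
  shows "\<exists>S'. moves S S' \<and> evading S'"
  using assms(1)
proof cases
  case (1 n)
  then have "moves S (loading E (n - 1) 0)"
    using assms(2) by (simp add: moves_Initial_iff)
  moreover have "evading (loading E (n - 1) 0)" using evading.intros(2)[of E] by simp
  ultimately show ?thesis by blast
next
  case (2 j a)
  show ?thesis
  proof (cases j)
    case 0
    let ?M = "replicate_mset a Idle + replicate_mset E (Unit 0)"
    have "moves S (add_mset (Ctl P) ?M)" using 2 0 moves_loading_iff[of 0] by simp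
    moreover have "evading (add_mset (Ctl P) ?M)"
      using holds_loaded by (intro evading.intros(3)[of P]) auto
    ultimately show ?thesis by blast
  next
    case (Suc i)
    have iff: "moves S S'' \<longleftrightarrow> (\<exists>a'. a = Suc a' \<and> S'' = loading i a' (E - i))" for S''
    proof -
      have "Suc (E - Suc i) = E - i" using 2(2) Suc by simp
      then show ?thesis
        using 2 Suc moves_loading_iff[of "Suc i" a "E - Suc i" S''] rcv_simps(5)[of i] by simp
    qed
    then obtain a' where "a = Suc a'" using assms(2) by blast
    then have "moves S (loading i a' (E - i))" using iff by simp
    moreover have "evading (loading i a' (E - i))" using 2 Suc by (intro evading.intros(2)) simp
    ultimately show ?thesis by blast
  qed
next
  case (3 k s M)
  have k: "k \<in> ctl P" using runs_ctl[OF 3(2) self_in_ctl] .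
  have crowd: "crowd M" using 3(3) by (simp add: holds_def)
  note iff = moves_Ctl_iff[OF k crowd]
  have next_run: "evading (add_mset (Ctl k') M')" if "run1 (k, s) (k', s')" "holds M' s'" for k' s' M'
    by (rule evading.intros(3)[OF rtranclp.rtrancl_into_rtrancl[OF 3(2) that(1)] that(2)])
  show ?thesis
  proof (cases k rule: lead.cases)
    case 1
    then show ?thesis using 3(2) diverges by blast
  next
    case (2 r k')
    have r: "r \<in> regs P" using regs_Inc k 2 by blast
    show ?thesis
    proof (cases "Idle \<in># M")
      case True
      then have "moves S (add_mset (Unit r) (add_mset (Ctl (after_inc r k)) (M - {#Idle#})))"
        unfolding 3(1) iff using r by blast
      moreover have "evading (add_mset (Ctl k') (add_mset (Unit r) (M - {#Idle#})))"
        using next_run run1_Inc holds_simps(1)[OF 3(3) r] 2 by blast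
      ultimately show ?thesis using 2 by (auto simp: add_mset_commute)
    next
      case False
      then have "moves S (add_mset Sink M)"
        unfolding 3(1) iff using 2 crowd_fixed(4)[OF crowd] by auto
      then show ?thesis using evading.intros(4)[OF crowd False] by blast
    qed
  next
    case (3 r b k')
    note k_eq = this
    show ?thesis
    proof (cases "s r")
      case 0
      then have "Unit r \<notin># M" using holds_Unit_iff[OF \<open>holds M s\<close>] by simp
      then have "moves S (add_mset (Ctl k') M)"
        unfolding \<open>S = add_mset (Ctl k) M\<close> iff using k_eq crowd_fixed(3)[OF crowd] by auto
      moreover have "evading (add_mset (Ctl k') M)"
        using next_run run1_exit[of s, OF 0] k_eq \<open>holds M s\<close> by blast
      ultimately show ?thesis by blast
    next
      case (Suc n)
      then have "Unit r \<in># M" using holds_Unit_iff[OF \<open>holds M s\<close>] by simp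
      then have "moves S (add_mset Idle (add_mset (Ctl (after_dec r k)) (M - {#Unit r#})))"
        unfolding \<open>S = add_mset (Ctl k) M\<close> iff by blast
      moreover have "evading (add_mset (Ctl (b @ Loop r b # k')) (add_mset Idle (M - {#Unit r#})))"
        using next_run run1_Loop[of s, OF Suc] k_eq holds_simps(2)[OF \<open>holds M s\<close> Suc] by blast
      ultimately show ?thesis using k_eq by (auto simp: add_mset_commute)
    qed
  qed
next
  case (4 M)
  \<comment> \<open>With no process in \<open>Idle\<close>, \<open>GiveUp\<close> changes nothing
    and can be repeated forever.\<close>
  have "moves S (add_mset Sink M)"
    unfolding mstep_def 4(1)
    by (intro exI[of _ Sink] exI[of _ GiveUp]) (simp add: Bcast_transitions_iff crowd_fixed(4) 4(2,3))
  then show ?thesis using assms(1) 4(1) by blast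
qed

lemma evading_Ctl_Nil:
  assumes "evading S" "Ctl [] \<in># S"
  obtains t where "runs (P, (\<lambda>_. 0)(0 := E)) ([], t)"
  using assms
proof cases
  case (3 k s M)
  then have "k = []" using assms(2) by (auto simp: holds_def crowd_def)
  with 3(2) that show ?thesis by blast
qed (auto simp: crowd_def split: if_splits)

lemma not_evading_if_wins:
  assumes "wins S" and diverges: "\<And>t. \<not> runs (P, (\<lambda>_. 0)(0 := E)) ([], t)"
  shows "\<not> evading S"
  using assms(1)
proof (induction rule: inevitable.induct)
  case (inevitable_now S)
  then show ?case using evading_Ctl_Nil diverges by blast
next
  case (inevitable_next S S')
  then show ?case using evading_moves diverges by blast
qed

lemma wins_iff_halts:
  "(\<exists>n. wins (replicate_mset n Initial)) \<longleftrightarrow> (\<exists>t. runs (P, (\<lambda>_. 0)(0 := E)) ([], t))"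
  using wins_initial_if_halts not_evading_if_wins evading.intros(1) by blast

end


section \<open>The reduction\<close>

text \<open>The states \<open>Load i\<close> and the edges between them are the only part of the protocol that depends on
  the input; their numbers are chosen so that the code of the protocol is computable.\<close>

fun state_num :: "st \<Rightarrow> nat" where
  "state_num (Load i) = 2 * i + 1"
| "state_num q = 2 * to_nat q"

lemma inj_state_num: "inj state_num"
proof (rule injI)
  have state_num: "state_num q = 2 * to_nat q" if "\<nexists>i. q = Load i" for q
    using that by (cases q) auto
  fix q q' assume eq: "state_num q = state_num q'"
  show "q = q'"
  proof (cases "\<exists>i. q = Load i")
    case True
    then have "odd (state_num q)" by auto
    then have "\<exists>i. q' = Load i" using state_num[of q'] eq by (metis dvd_triv_left)
    with True eq show ?thesis by auto
  next
    case False
    then have "even (state_num q)" using state_num by simp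
    then have "\<nexists>i. q' = Load i" using eq by auto
    then show ?thesis using state_num False eq by simp
  qed
qed

definition msg_num :: "msg \<Rightarrow> nat" where
  "msg_num = to_nat"

lemma inj_msg_num: "inj msg_num"
  by (simp add: msg_num_def)

definition edge :: "st \<times> msg act \<times> st \<Rightarrow> (nat, nat, nat, nat) edge" where
  "edge = (\<lambda>(q, a, q'). (state_num q, {}, map_act msg_num a, {}, state_num q'))"

text \<open>The name sets are initial segments, whose codes are computable. The bound exceeds
  \<open>2 * E + 1\<close>, the number of \<open>Load E\<close>, and for \<open>E = index P\<close>
  also all names in \<open>base P\<close>.\<close>

definition protocol :: "prog \<Rightarrow> nat \<Rightarrow> nat_ptbp" where
  "protocol P E = \<lparr>states = {..<2 * E + 2}, clocks = {}, alphabet = {..<2 * E + 2}, params = {},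
     init = state_num Initial, edges = edge ` transitions P E\<rparr>"

text \<open>Injectivity turns the code of a set of edges into a sum of powers of two over these
  edges.\<close>

lemma inj_edge_code_edge: "inj (\<lambda>e. edge_code (edge e))"
proof -
  have "inj edge"
    using injD[OF inj_state_num] injD[OF act.inj_map[OF inj_msg_num]]
    by (auto simp: inj_def edge_def)
  moreover have "inj_on edge_code (range edge)"
    by (rule edge_code_inj) (auto simp: edge_def)
  ultimately show ?thesis using comp_inj_on[of edge UNIV edge_code] by (simp add: comp_def)
qed

text \<open>The program is run on the code of the protocol's input-independent edges.\<close>

definition index :: "prog \<Rightarrow> nat" where
  "index P = set_encode ((\<lambda>e. edge_code (edge e)) ` base P)"

lemma less_list_encode: "x \<in> set xs \<Longrightarrow> x < list_encode xs"
proof (induction xs)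
  case (Cons y xs)
  then show ?case
    using le_prod_encode_1[of y "list_encode xs"] le_prod_encode_2[of "list_encode xs" y]
    by auto
qed simp

lemma less_act_code: "m \<in> set_act a \<Longrightarrow> m < act_code a"
  by (cases a) (auto simp: sum_encode_def)

text \<open>A name is below the code of its edge, which is below its power of two, a summand of
  \<open>index P\<close>.\<close>

lemma less_index:
  assumes "(q, a, q') \<in> base P"
  shows "state_num q < index P" "state_num q' < index P" "m \<in> set_act a \<Longrightarrow> msg_num m < index P"
proof -
  let ?c = "edge_code (edge (q, a, q'))"
  have "?c < 2 ^ ?c" by (rule less_exp)
  also have "\<dots> \<le> index P"
    unfolding index_def set_encode_def using assms finite_base
    by (intro member_le_sum[where f = "(^) 2"]) auto
  finally have c: "?c < index P" .
  have less: "x < ?c" if "x \<in> {state_num q, act_code (map_act msg_num a), state_num q'}" for x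
    using that unfolding edge_def prod.case edge_code.simps by (intro less_list_encode) auto
  show "state_num q < index P" "state_num q' < index P" using c less by (meson insertCI less_trans)+
  show "msg_num m < index P" if "m \<in> set_act a"
    using that less_act_code[of "msg_num m" "map_act msg_num a"] c less[of "act_code (map_act msg_num a)"]
    by (auto simp: act.set_map)
qed

text \<open>These edges mention \<open>Initial\<close>, \<open>Elect\<close>, \<open>Draw\<close>
  and \<open>Ctl []\<close>, so \<open>less_index\<close> bounds their names.\<close>

lemma base_members:
  "(Initial, Recv Elect, Fresh) \<in> base P" "(Load 0, Recv Draw, Ctl []) \<in> base P"
  by (force simp: base_def reactive_def)+

lemma wf_protocol: "wf_ptbp (protocol P (index P))"
proof -
  have "state_num q < 2 * index P + 2 \<and> state_num q' < 2 * index P + 2 \<and>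
      (\<forall>m \<in> set_act a. msg_num m < 2 * index P + 2)" if "(q, a, q') \<in> transitions P (index P)" for q a q'
    using that less_index[OF base_members(1)[of P]] less_index[OF base_members(2)[of P]]
    unfolding transitions_def by (auto dest: less_index)
  moreover have "finite (transitions P (index P))" by (simp add: transitions_def finite_base)
  ultimately show ?thesis
    using less_index(1)[OF base_members(1)[of P]]
    by (fastforce simp: wf_ptbp_def protocol_def edge_def guard_over_def act.set_map)
qed

lemma exists_AF_protocol_iff:
  "exists_AF (protocol P (index P)) (state_num (Ctl [])) \<longleftrightarrow>
     (\<exists>t. runs (P, (\<lambda>_. 0)(0 := index P)) ([], t))"
proof -
  interpret broadcast_protocol "protocol P (index P)" "transitions P (index P)" "rcv P (index P)" state_num msg_num
    Initial
  proof
    show "wf_ptbp (protocol P (index P))" by (rule wf_protocol)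
  qed (use inj_state_num inj_msg_num Internal_notin_transitions Recv_transitions rcv_transitions
      in \<open>auto simp: protocol_def edge_def\<close>)
  show ?thesis unfolding exists_AF_iff by (rule wins_iff_halts)
qed

text \<open>The code of the instance in a form that \<open>computable1_intros\<close> can handle.
  For \<open>e = index P\<close> the number \<open>e\<close> is already the code of the edges in
  \<open>base P\<close>; each input-dependent edge adds a further power of two. The zeros in the
  lists are codes of empty sets.\<close>

definition instance_number :: "nat \<Rightarrow> nat" where
  "instance_number e =
     (let bound = (\<Sum>i<e + e + 2. 2 ^ i) in
      prod_encode (list_encode [bound, 0, bound, 0, state_num Initial,
        e + (2 ^ list_encode [state_num Initial, 0, act_code (Bcast (msg_num Elect)), 0, Suc (e + e)] +
          (\<Sum>i<e. 2 ^ list_encode [Suc (Suc i + Suc i), 0, act_code (Recv (msg_num Draw)), 0, Suc (i + i)]))],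
        state_num (Ctl [])))"

lemma computable1_instance_number: "computable1 instance_number"
  unfolding instance_number_def Let_def by (intro computable1_intros)

lemma set_encode_lessThan: "set_encode {..<n} = (\<Sum>i<n. 2 ^ i)"
  by (simp add: set_encode_def)

lemma instance_code_protocol:
  "instance_code (protocol P (index P), state_num (Ctl [])) = instance_number (index P)"
proof -
  let ?E = "index P" and ?c = "\<lambda>e. edge_code (edge e)"
  let ?start = "(Initial, Bcast Elect, Load ?E)" and ?load = "\<lambda>i. (Load (Suc i), Recv Draw, Load i)"
  have code: "set_encode (?c ` A) = (\<Sum>e\<in>A. 2 ^ ?c e)" for A
    using inj_on_subset[OF inj_edge_code_edge] by (simp add: set_encode_def sum.reindex)
  have new: "?start \<notin> base P" "?load i \<notin> base P" for i
    by (auto simp: base_def in_lead_iff reactive_def)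
  have inj: "inj_on ?load {..<?E}" by (auto simp: inj_on_def)
  have "set_encode (?c ` transitions P ?E) = (\<Sum>e\<in>base P. 2 ^ ?c e) +
      (\<Sum>e\<in>insert ?start (?load ` {..<?E}). 2 ^ ?c e)"
    unfolding code transitions_def using new by (intro sum.union_disjoint) (auto simp: finite_base)
  \<comment> \<open>Self-reference: the number loaded as input is the code of the base
    edges.\<close>
  also have "(\<Sum>e\<in>base P. 2 ^ ?c e) = ?E"
    unfolding index_def code ..
  also have "(\<Sum>e\<in>insert ?start (?load ` {..<?E}). 2 ^ ?c e) =
      2 ^ ?c ?start + (\<Sum>e\<in>?load ` {..<?E}. 2 ^ ?c e)"
    by (intro sum.insert) auto
  also have "(\<Sum>e\<in>?load ` {..<?E}. 2 ^ ?c e) = (\<Sum>i<?E. 2 ^ ?c (?load i))"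
    unfolding sum.reindex[OF inj] by simp
  finally have "set_encode (?c ` transitions P ?E) = ?E + (2 ^ ?c ?start + (\<Sum>i<?E. 2 ^ ?c (?load i)))" .
  then have "set_encode (edge_code ` edge ` transitions P ?E) =
      ?E + (2 ^ ?c ?start + (\<Sum>i<?E. 2 ^ ?c (?load i)))"
    by (simp add: image_image)
  then show ?thesis
    unfolding instance_code_def ptbp_code_def protocol_def instance_number_def Let_def
    by (simp add: edge_def set_encode_lessThan mult_2 del: list_encode.simps act_code.simps)
qed

section \<open>The diagonal argument\<close>

text \<open>\<open>run1\<close> is deterministic and \<open>[]\<close> has no successor, so a
  terminating run passes through every configuration reachable from its start.\<close>

lemma runs_final:
  assumes "runs c c'" "runs c ([], t)"
  shows "runs c' ([], t)"
  using assms
proof (induction rule: rtranclp_induct)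
  case (step c1 c2)
  from step.IH[OF step.prems] step.hyps(2) show ?case
    by (cases rule: converse_rtranclpE) (auto elim!: run1.cases)
qed

text \<open>The body undoes the decrement, so \<open>r\<close> is positive at every test.\<close>

lemma runs_loop_forever:
  assumes "runs ([Loop r [Inc r]], s) (k, t)" "s r > 0"
  shows "k \<noteq> []"
proof -
  have "k = [Loop r [Inc r]] \<and> t r > 0 \<or> k = [Inc r, Loop r [Inc r]]"
    using assms by (induction rule: rtranclp_induct2) (auto elim!: run1.cases)
  then show ?thesis by auto
qed

theorem theorem4:
  shows "\<not> decidable instance_code
           {(N, qf). wf_ptbp N \<and> clocks N = {} \<and> qf \<in> states N}
           (\<lambda>(N, qf). exists_AF N qf)"
proof
  assume "decidable instance_code {(N, qf). wf_ptbp N \<and> clocks N = {} \<and> qf \<in> states N}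
    (\<lambda>(N, qf). exists_AF N qf)"
  then obtain f where f: "\<And>N qf. wf_ptbp N \<Longrightarrow> clocks N = {} \<Longrightarrow> qf \<in> states N \<Longrightarrow>
      rec_eval f [instance_code (N, qf)] (if exists_AF N qf then 1 else 0)"
    unfolding decidable_def by fastforce
  obtain g where g: "rec_eval g [x] (instance_number x)" for x
    using computable1_instance_number unfolding computable1_def by blast
  \<comment> \<open>Input in register 0, answer in register 1; \<open>Comp f [g]\<close> runs the
    algorithm on the instance built from the input.\<close>
  obtain p where p: "implements p (Comp f [g]) [0] 1 2"
    by (rule compilableD[OF compilable, of "[0]" 2 1]) auto
  \<comment> \<open>The appended loop terminates exactly if the answer is 0.\<close>
  define P where "P = p @ [Loop 1 [Inc 1]]"
  let ?N = "protocol P (index P)" and ?qf = "state_num (Ctl [])" and ?s = "(\<lambda>_. 0)(0 := index P)"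
  have "?qf \<in> states ?N" "clocks ?N = {}"
    using less_index(2)[OF base_members(2)[of P]] by (auto simp: protocol_def)
  \<comment> \<open>The instance built from \<open>index P\<close> is the protocol that simulates
    \<open>P\<close> itself.\<close>
  then have "rec_eval f [instance_number (index P)] (if exists_AF ?N ?qf then 1 else 0)"
    using f wf_protocol instance_code_protocol by metis
  then have "rec_eval (Comp f [g]) (map ?s [0]) (if exists_AF ?N ?qf then 1 else 0)"
    using rec_eval_Comp1[OF g] by simp
  from implementsD[OF p this] obtain t where
    t: "exec p ?s t" "t 1 = (if exists_AF ?N ?qf then 1 else 0)" by metis
  have run: "runs (P, ?s) ([Loop 1 [Inc 1]], t)"
    using t(1) unfolding exec_def P_def by blast
  show False
  proof (cases "exists_AF ?N ?qf")
    case True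
    then obtain u where "runs (P, ?s) ([], u)" unfolding exists_AF_protocol_iff by blast
    then have "runs ([Loop 1 [Inc 1]], t) ([], u)" by (rule runs_final[OF run])
    then show False using runs_loop_forever t(2) True by fastforce
  next
    case False
    then have "run1 ([Loop 1 [Inc 1]], t) ([], t)" using t(2) by (intro run1_exit) simp
    then have "runs (P, ?s) ([], t)" by (rule rtranclp.rtrancl_into_rtrancl[OF run])
    then show False using False unfolding exists_AF_protocol_iff by blast
  qed
qed

end
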